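(* Let $\phi: P_n\rightarrow P_n$ be a map and let $\alpha=(\det \phi(I))^{1/n}$ (the positive $n$-th root). Then the following statements are equivalent. (1) There exists an invertible matrix $M\in M_n$ with $\det (M^*M)=1$ such that either $\phi(A)=\alpha M^{*}AM$ for all $A\in P_n$, or $\phi(A)=\alpha M^{*}A^{t}M$ for all $A\in P_n$. (2) $\det(\phi(A)+\phi(B))=\alpha^n\det(A+B)$ for all $A,B \in P_n$. (3) $\operatorname{tr}(\phi(A)\phi(B)^{-1})=\operatorname{tr}(AB^{-1})$ for all $A,B \in P_n$.
   Context: $M_n$ is the set of $n\times n$ complex matrices and $P_n$ is the set of positive definite (Hermitian) matrices in $M_n$. $I$ is the $n\times n$ identity matrix, $A^t$ is the transpose and $A^*$ the conjugate transpose of $A$. The map $\phi$ is not assumed linear, continuous, injective or surjective. *)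

theory Defs
  imports "HOL-Analysis.Analysis"
begin

definition conj_transpose :: "complex^'n^'m \<Rightarrow> complex^'m^'n" where
  "conj_transpose A = (\<chi> i j. cnj (A $ j $ i))"

definition hermitian_matrix :: "complex^'n^'n \<Rightarrow> bool" where
  "hermitian_matrix A \<longleftrightarrow> conj_transpose A = A"

(* The sum is the quadratic form x^* A x; it is real because A is Hermitian,
   so taking the real part loses nothing. *)
definition pos_def_matrices :: "(complex^'n^'n) set" where
  "pos_def_matrices =
     {A. hermitian_matrix A \<and>
         (\<forall>x. x \<noteq> 0 \<longrightarrow> 0 < Re (\<Sum>i\<in>UNIV. cnj (x $ i) * (A *v x) $ i))}"

end

theory Submission
  imports Defs
begin

text \<open>(1) implies (2) by multiplicativity of the determinant.

  (2) implies (3): the equality case of Minkowski's determinant inequality turns the determinant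
  condition into positive homogeneity of \<open>\<phi>\<close>; so \<open>det (\<phi>(A) + t \<phi>(B))\<close> is proportional to
  \<open>det (A + t B)\<close> for all \<open>t > 0\<close>, and comparing first order terms gives the trace condition.

  (3) implies (1): normalise to \<open>\<phi>(I) = I\<close>. On Hermitian matrices \<open>tr (A B)\<close> is the real inner
  product, and the positive definite matrices span this space. Hence (3) says that \<open>\<phi>\<close> and
  \<open>C \<mapsto> \<phi>(C\<^sup>-\<^sup>1)\<^sup>-\<^sup>1\<close> are dual to each other, which forces both to extend to linear maps \<open>F\<close>, \<open>G\<close>
  with \<open>G(A\<^sup>-\<^sup>1) = F(A)\<^sup>-\<^sup>1\<close>. Applying this to
  \<open>(I + X)\<^sup>-\<^sup>1 + (I - X)\<^sup>-\<^sup>1 = 2 (I - X\<^sup>2)\<^sup>-\<^sup>1\<close> yields \<open>F(X\<^sup>2) = F(X)\<^sup>2\<close>. Such a Jordan map sends the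
  diagonal matrix units to mutually orthogonal projections; after a unitary change of basis it fixes
  them, hence acts on each off-diagonal entry by a real-linear isometry of the plane, and Jordan
  products of neighbouring entries force all these isometries to be of the same type, either all
  direct or all conjugate-linear.\<close>

section \<open>Complex matrices and positive definiteness\<close>

lemma matrix_mul_add_left: "(A + B) ** C = A ** C + B ** (C :: 'a::semiring_1^'p^'n)"
  by (vector matrix_matrix_mult_def sum.distrib[symmetric] field_simps)

lemma matrix_mul_diff_left: "(A - B) ** C = A ** C - B ** (C :: 'a::ring_1^'p^'n)"
  by (vector matrix_matrix_mult_def sum_subtractf[symmetric] left_diff_distrib)

lemma matrix_mul_diff_right: "C ** (A - B) = C ** A - C ** (B :: 'a::ring_1^'p^'n)"
  by (vector matrix_matrix_mult_def sum_subtractf[symmetric] right_diff_distrib)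

lemmas matrix_ring_simps =
  matrix_mul_add_left matrix_add_ldistrib matrix_mul_diff_left matrix_mul_diff_right
  scalar_matrix_assoc[symmetric] matrix_scalar_ac

lemma matrix_scaleR_vector: "(c *\<^sub>R A) *v x = c *\<^sub>R (A *v (x :: 'a::real_algebra_1^'n))"
  by (vector matrix_vector_mult_def scaleR_right.sum)

lemma matrix_vector_minus: "(- A) *v x = - (A *v (x :: 'a::ring_1^'n))"
  by (vector matrix_vector_mult_def sum_negf[symmetric])

lemma det_scaleR: "det (c *\<^sub>R A) = of_real c ^ CARD('n) * det (A :: complex^'n^'n)"
  unfolding det_def vector_scaleR_component
  by (simp add: scaleR_conv_of_real prod.distrib sum_distrib_left mult_ac)

lemma matrix_inv_eq:
  fixes A :: "'a::field^'n^'n"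
  assumes "A ** B = mat 1" shows "matrix_inv A = B"
proof -
  have BA: "B ** A = mat 1" using assms matrix_left_right_inverse by blast
  have "A ** matrix_inv A = mat 1 \<and> matrix_inv A ** A = mat 1"
    unfolding matrix_inv_def by (rule someI[of _ B]) (simp add: assms BA)
  then have "matrix_inv A = (B ** A) ** matrix_inv A" "B = B ** (A ** matrix_inv A)"
    by (simp_all add: BA)
  then show ?thesis by (simp add: matrix_mul_assoc)
qed

lemma matrix_inv_mult:
  fixes A :: "'a::field^'n^'n"
  assumes "invertible A"
  shows "A ** matrix_inv A = mat 1" "matrix_inv A ** A = mat 1"
proof -
  obtain B where "A ** B = mat 1" "B ** A = mat 1"
    using assms unfolding invertible_def by blast
  with matrix_inv_eq[OF this(1)]
  show "A ** matrix_inv A = mat 1" "matrix_inv A ** A = mat 1" by simp_all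
qed

lemma invertible_matrix_inv:
  fixes A :: "'a::field^'n^'n"
  assumes "invertible A" shows "invertible (matrix_inv A)" "matrix_inv (matrix_inv A) = A"
proof -
  show "invertible (matrix_inv A)"
    unfolding invertible_def using matrix_inv_mult[OF assms] by blast
  show "matrix_inv (matrix_inv A) = A"
    by (rule matrix_inv_eq) (rule matrix_inv_mult(2)[OF assms])
qed

lemma conj_transpose_conj_transpose [simp]: "conj_transpose (conj_transpose A) = A"
  by (simp add: conj_transpose_def vec_eq_iff)

lemma conj_transpose_mult: "conj_transpose (A ** B) = conj_transpose B ** conj_transpose A"
  by (simp add: conj_transpose_def vec_eq_iff matrix_matrix_mult_def mult.commute)

lemma conj_transpose_add: "conj_transpose (A + B) = conj_transpose A + conj_transpose B"
  by (simp add: conj_transpose_def vec_eq_iff)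

lemma conj_transpose_minus: "conj_transpose (- A) = - conj_transpose A"
  by (simp add: conj_transpose_def vec_eq_iff)

lemma conj_transpose_scaleR: "conj_transpose (c *\<^sub>R A) = c *\<^sub>R conj_transpose A"
  by (simp add: conj_transpose_def vec_eq_iff)

lemma conj_transpose_mat_1 [simp]: "conj_transpose (mat 1) = mat 1"
  by (simp add: conj_transpose_def vec_eq_iff mat_def)

section \<open>The Hermitian inner product and its real part\<close>

definition cinner :: "complex^'n \<Rightarrow> complex^'n \<Rightarrow> complex" where
  "cinner x y = (\<Sum>i\<in>UNIV. cnj (x $ i) * y $ i)"

text \<open>The bridge to the underlying real Euclidean space: the variational argument for
  eigenvectors works with \<open>\<bullet>\<close>, orthonormality and adjoints with
  \<open>cinner\<close>.\<close>

lemma inner_eq_Re_cinner: "x \<bullet> y = Re (cinner x y)"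
  by (simp add: inner_vec_def inner_complex_def cinner_def)

lemma cinner_commute: "cinner x y = cnj (cinner y x)"
  by (simp add: cinner_def mult.commute)

lemma cinner_self: "cinner x x = of_real ((norm x)\<^sup>2)"
proof -
  have "cinner x x = of_real (Re (cinner x x))"
    using cinner_commute[of x x] by (metis Reals_cnj_iff of_real_Re)
  then show ?thesis
    by (simp add: inner_eq_Re_cinner[symmetric] power2_norm_eq_inner)
qed

lemma cinner_scaleR_left: "cinner (c *\<^sub>R x) y = of_real c * cinner x y"
  by (simp add: cinner_def sum_distrib_left scaleR_conv_of_real[where 'a=complex] mult_ac)

lemma cinner_scaleR_right: "cinner x (c *\<^sub>R y) = of_real c * cinner x y"
  by (simp add: cinner_def sum_distrib_left scaleR_conv_of_real[where 'a=complex] mult_ac)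

lemma cinner_add_right: "cinner x (y + z) = cinner x y + cinner x z"
  by (simp add: cinner_def sum.distrib distrib_left)

lemma cinner_matrix_vector:
  fixes A :: "complex^'n^'n"
  shows "cinner (A *v x) y = cinner x (conj_transpose A *v y)"
proof -
  have "(\<Sum>i\<in>UNIV. cnj ((A *v x) $ i) * y $ i)
      = (\<Sum>i\<in>UNIV. \<Sum>j\<in>UNIV. cnj (A $ i $ j) * cnj (x $ j) * y $ i)"
    by (simp add: matrix_vector_mult_def sum_distrib_right)
  also have "\<dots> = (\<Sum>j\<in>UNIV. \<Sum>i\<in>UNIV. cnj (A $ i $ j) * cnj (x $ j) * y $ i)"
    by (rule sum.swap)
  also have "\<dots> = (\<Sum>j\<in>UNIV. cnj (x $ j) * (conj_transpose A *v y) $ j)"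
    by (simp add: matrix_vector_mult_def conj_transpose_def sum_distrib_left mult_ac)
  finally show ?thesis by (simp only: cinner_def)
qed

lemma inner_matrix_vector: "(A *v x) \<bullet> y = x \<bullet> (conj_transpose A *v y)"
  for A :: "complex^'n^'n"
  by (simp only: inner_eq_Re_cinner cinner_matrix_vector)

text \<open>For Hermitian \<open>A\<close> the entry \<open>A $ j $ i\<close> is the conjugate of
  \<open>A $ i $ j\<close>, so the trace is the Hermitian pairing of entries. This turns condition
  (3) into a statement about real inner products.\<close>

lemma hermitian_trace_inner:
  fixes A B :: "complex^'n^'n"
  assumes "hermitian_matrix A"
  shows "Re (trace (A ** B)) = A \<bullet> B"
proof -
  have *: "A $ i $ j = cnj (A $ j $ i)" for i j
    using assms by (simp add: hermitian_matrix_def conj_transpose_def vec_eq_iff)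
  have "trace (A ** B) = (\<Sum>i\<in>UNIV. \<Sum>j\<in>UNIV. A $ j $ i * B $ i $ j)"
    by (simp add: trace_def matrix_matrix_mult_def) (rule sum.swap)
  also have "\<dots> = (\<Sum>i\<in>UNIV. \<Sum>j\<in>UNIV. cnj (A $ i $ j) * B $ i $ j)"
    by (subst *) simp
  finally show ?thesis by (simp add: inner_vec_def inner_complex_def)
qed

section \<open>The cone of positive definite matrices\<close>

lemma pos_def_alt:
  "A \<in> pos_def_matrices \<longleftrightarrow> hermitian_matrix A \<and> (\<forall>x. x \<noteq> 0 \<longrightarrow> 0 < x \<bullet> (A *v x))"
  by (simp only: pos_def_matrices_def inner_eq_Re_cinner cinner_def mem_Collect_eq)

lemma pos_def_hermitian: "A \<in> pos_def_matrices \<Longrightarrow> hermitian_matrix A"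
  by (simp add: pos_def_alt)

lemma pos_def_conj_transpose: "A \<in> pos_def_matrices \<Longrightarrow> conj_transpose A = A"
  by (simp add: pos_def_alt hermitian_matrix_def)

lemma pos_def_invertible:
  assumes "A \<in> pos_def_matrices" shows "invertible A"
proof -
  have "x = 0" if "A *v x = 0" for x
    using assms that by (force simp: pos_def_alt)
  then show ?thesis
    using invertible_left_inverse matrix_left_invertible_ker by blast
qed

lemma pos_def_mat_1: "mat 1 \<in> pos_def_matrices"
  by (simp add: pos_def_alt hermitian_matrix_def)

lemma pos_def_scaleR:
  assumes "A \<in> pos_def_matrices" "c > 0"
  shows "c *\<^sub>R A \<in> pos_def_matrices"
  using assms by (simp add: pos_def_alt hermitian_matrix_def conj_transpose_scaleR
      matrix_scaleR_vector)

lemma invertible_matrix_vector_eq_0: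
  fixes S :: "'a::field^'n^'n"
  assumes "invertible S" "S *v x = 0" shows "x = 0"
proof -
  have "x = matrix_inv S *v (S *v x)"
    by (simp add: matrix_vector_mul_assoc matrix_inv_mult assms(1))
  then show ?thesis by (simp add: assms(2))
qed

lemma pos_def_congruence:
  fixes A S :: "complex^'n^'n"
  assumes "A \<in> pos_def_matrices" "invertible S"
  shows "conj_transpose S ** A ** S \<in> pos_def_matrices"
  unfolding pos_def_alt
proof (intro conjI allI impI)
  show "hermitian_matrix (conj_transpose S ** A ** S)"
    using pos_def_conj_transpose[OF assms(1)]
    by (simp add: hermitian_matrix_def conj_transpose_mult matrix_mul_assoc)
  fix x :: "complex^'n" assume "x \<noteq> 0"
  then have "S *v x \<noteq> 0" using invertible_matrix_vector_eq_0[OF assms(2)] by blast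
  then have "0 < (S *v x) \<bullet> (A *v (S *v x))"
    using assms(1) by (simp add: pos_def_alt)
  then show "0 < x \<bullet> (conj_transpose S ** A ** S *v x)"
    by (simp only: inner_matrix_vector matrix_vector_mul_assoc matrix_mul_assoc)
qed

lemma conj_transpose_inv:
  fixes A :: "complex^'n^'n"
  assumes "invertible A"
  shows "invertible (conj_transpose A)" "matrix_inv (conj_transpose A) = conj_transpose (matrix_inv A)"
proof -
  have *: "conj_transpose A ** conj_transpose (matrix_inv A) = mat 1"
    by (simp add: matrix_inv_mult assms flip: conj_transpose_mult)
  then show "matrix_inv (conj_transpose A) = conj_transpose (matrix_inv A)"
    by (rule matrix_inv_eq)
  show "invertible (conj_transpose A)"
    using * invertible_right_inverse by blast
qed

text \<open>The inverse is the congruence of \<open>A\<close> by \<open>matrix_inv A\<close>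
  itself.\<close>

lemma pos_def_inverse:
  assumes "A \<in> pos_def_matrices" shows "matrix_inv A \<in> pos_def_matrices"
proof -
  note inv = pos_def_invertible[OF assms]
  have "conj_transpose (matrix_inv A) ** A ** matrix_inv A = matrix_inv A"
    using conj_transpose_inv(2)[OF inv] pos_def_conj_transpose[OF assms] matrix_inv_mult[OF inv]
    by simp
  then show ?thesis
    using pos_def_congruence[OF assms invertible_matrix_inv(1)[OF inv]] by simp
qed

section \<open>The spectral theorem\<close>

text \<open>A maximiser \<open>x\<close> of the Rayleigh quotient on the unit sphere of
  \<open>W\<close> is an eigenvector: if the residual \<open>z\<close> were nonzero, moving from
  \<open>x\<close> towards \<open>z\<close> would increase the quotient to first order.\<close>

lemma selfadjoint_eigenvector:
  fixes T :: "'a::euclidean_space \<Rightarrow> 'a"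
  assumes lin: "linear T" and adj: "\<And>x y. T x \<bullet> y = x \<bullet> T y"
    and W: "subspace W" "\<And>x. x \<in> W \<Longrightarrow> T x \<in> W" and w: "w \<in> W" "w \<noteq> 0"
  shows "\<exists>x\<in>W. norm x = 1 \<and> (\<exists>l. T x = l *\<^sub>R x)"
proof -
  define K where "K = W \<inter> sphere 0 1"
  have K: "compact K"
    unfolding K_def using closed_subspace[OF W(1)] by (intro closed_Int_compact) auto
  have "(1 / norm w) *\<^sub>R w \<in> K"
    using w W(1) by (simp add: K_def subspace_scale)
  then have K0: "K \<noteq> {}" by blast
  have cont: "continuous_on K (\<lambda>x. x \<bullet> T x)"
    using lin by (intro continuous_intros linear_continuous_on) (simp add: linear_linear)
  obtain x where x: "x \<in> K" "\<And>y. y \<in> K \<Longrightarrow> y \<bullet> T y \<le> x \<bullet> T x"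
    using continuous_attains_sup[OF K K0 cont] by blast
  define l where "l = x \<bullet> T x"
  have xW: "x \<in> W" and xx: "x \<bullet> x = 1"
    using x(1) by (auto simp: K_def norm_eq_1)
  have bound: "y \<bullet> T y \<le> l * (y \<bullet> y)" if "y \<in> W" for y
  proof (cases "y = 0")
    case False
    have "(1 / norm y) *\<^sub>R y \<in> K"
      using that False W(1) by (simp add: K_def subspace_scale)
    from x(2)[OF this] have "(y \<bullet> T y) / (norm y * norm y) \<le> l"
      by (simp add: linear_scale[OF lin] l_def)
    then show ?thesis
      using False by (simp add: field_simps dot_square_norm power2_eq_square)
  qed (simp add: linear_0[OF lin])
  define z where "z = T x - l *\<^sub>R x"
  have zW: "z \<in> W"
    unfolding z_def using W xW by (simp add: subspace_diff subspace_scale)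
  define c where "c = l * (z \<bullet> z) - z \<bullet> T z"
  have c: "c \<ge> 0" using bound[OF zW] by (simp add: c_def)
  \<comment> \<open>This is \<open>bound\<close> at \<open>x + s z\<close>: the terms of order zero
    cancel, the first-order gain is \<open>2 s (z \<bullet> z)\<close>, and the second-order terms
    are collected in \<open>s^2 c\<close>.\<close>
  have var: "2 * (z \<bullet> z) \<le> s * c" if "s > 0" for s
  proof -
    have "x + s *\<^sub>R z \<in> W" using W xW zW by (simp add: subspace_add subspace_scale)
    note bound' = bound[OF this]
    have XZ: "x \<bullet> T z = z \<bullet> T x" by (metis adj inner_commute)
    from bound'
    have "x \<bullet> T x + s * (x \<bullet> T z) + s * (z \<bullet> T x) + s * s * (z \<bullet> T z)
        \<le> l * (x \<bullet> x + 2 * s * (x \<bullet> z) + s * s * (z \<bullet> z))"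
      by (simp add: linear_add[OF lin] linear_scale[OF lin] inner_simps inner_commute[of z x]
          algebra_simps)
    then have "l + 2 * s * (z \<bullet> T x) + s * s * (z \<bullet> T z)
        \<le> l * (1 + 2 * s * (x \<bullet> z) + s * s * (z \<bullet> z))"
      using XZ xx by (simp add: l_def[symmetric])
    moreover have "z \<bullet> T x = z \<bullet> z + l * (x \<bullet> z)"
      by (subst (2) z_def) (simp add: inner_diff_right inner_commute)
    ultimately have "s * (2 * (z \<bullet> z)) \<le> s * (s * c)"
      by (simp add: c_def algebra_simps)
    then show ?thesis using that by simp
  qed
  have "z \<bullet> z = 0"
  proof (rule ccontr)
    assume "z \<bullet> z \<noteq> 0"
    then have "z \<bullet> z > 0" by simp
    \<comment> \<open>This choice of \<open>s\<close> keeps \<open>s * c\<close> at most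
      \<open>z \<bullet> z\<close>, half of what \<open>var\<close> demands.\<close>
    moreover have "2 * (z \<bullet> z) \<le> (z \<bullet> z) / (c + 1) * c"
      using var[of "(z \<bullet> z) / (c + 1)"] c calculation by simp
    moreover have "(z \<bullet> z) / (c + 1) * c \<le> z \<bullet> z"
      using c by (simp add: field_simps)
    ultimately show False by linarith
  qed
  then have "T x = l *\<^sub>R x" by (simp add: z_def)
  with xW xx show ?thesis by (auto simp: norm_eq_1)
qed

text \<open>Induction over the index set: the complement of the eigenvectors found so far is
  invariant and, while an index is missing, nonzero, so it contains a further one. The eigenvalues
  come out real because \<open>A\<close> is treated as a symmetric map of the underlying real
  space.\<close>

lemma hermitian_orthonormal_eigenvectors:
  fixes A :: "complex^'n^'n" and K :: "'n set"
  assumes A: "hermitian_matrix A"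
  shows "\<exists>u (d :: 'n \<Rightarrow> real). \<forall>i\<in>K. A *v u i = d i *\<^sub>R u i \<and>
    (\<forall>j\<in>K. cinner (u i) (u j) = (if i = j then 1 else 0))"
  using finite[of K]
proof (induction K)
  case (insert k K)
  then obtain u and d :: "'n \<Rightarrow> real"
    where u: "\<And>i. i \<in> K \<Longrightarrow> A *v u i = d i *\<^sub>R u i"
      and on: "\<And>i j. i \<in> K \<Longrightarrow> j \<in> K \<Longrightarrow> cinner (u i) (u j) = (if i = j then 1 else 0)"
    by blast
  define W where "W = {x. \<forall>i\<in>K. cinner (u i) x = 0}"
  have sub: "subspace W"
    by (auto simp: subspace_def W_def cinner_add_right cinner_scaleR_right) (simp add: cinner_def)
  have adj: "(A *v x) \<bullet> y = x \<bullet> (A *v y)" for x y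
    using A by (simp add: inner_matrix_vector hermitian_matrix_def)
  have inv: "A *v x \<in> W" if "x \<in> W" for x
  proof -
    have "cinner (u i) (A *v x) = 0" if "i \<in> K" for i
    proof -
      have "cinner (u i) (A *v x) = cinner (A *v u i) x"
        using A by (simp add: cinner_matrix_vector hermitian_matrix_def)
      then show ?thesis
        using \<open>x \<in> W\<close> that by (simp add: u cinner_scaleR_left W_def)
    qed
    then show ?thesis by (simp add: W_def)
  qed
  obtain w where w: "w \<in> W" "w \<noteq> 0"
  proof -
    \<comment> \<open>The rows indexed by \<open>K\<close> are the conjugated eigenvectors and row
      \<open>k\<close> is zero. Hence \<open>M\<close> is singular, and a kernel vector is
      orthogonal to all \<open>u i\<close> with \<open>i\<close> in \<open>K\<close>.\<close>
    define M where "M = (\<chi> i j. if i \<in> K then cnj (u i $ j) else 0)"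
    have "row k M = 0" using insert.hyps by (simp add: M_def row_def vec_eq_iff)
    then have "\<not> invertible M" by (simp add: invertible_det_nz det_zero_row)
    then obtain w where w: "w \<noteq> 0" "M *v w = 0"
      using matrix_left_invertible_ker[of M] invertible_left_inverse[of M] by blast
    have "cinner (u i) w = (M *v w) $ i" if "i \<in> K" for i
      using that by (simp add: M_def cinner_def matrix_vector_mult_def)
    then have "w \<in> W" by (simp add: W_def w)
    with w that show ?thesis by blast
  qed
  obtain x l where x: "x \<in> W" "norm x = 1" "A *v x = l *\<^sub>R x"
    using selfadjoint_eigenvector[OF _ adj sub inv w] by auto
  have xu: "cinner (u i) x = 0" "cinner x (u i) = 0" if "i \<in> K" for i
    using x(1) that cinner_commute[of x "u i"] by (simp_all add: W_def)
  have xx: "cinner x x = 1" by (simp add: cinner_self x)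
  show ?case
    by (rule exI[of _ "u(k := x)"], rule exI[of _ "d(k := l)"])
      (use insert.hyps x xu xx u on in auto)
qed simp

definition diag_real :: "('n \<Rightarrow> real) \<Rightarrow> complex^'n^'n" where
  "diag_real d = (\<chi> i j. if i = j then of_real (d i) else 0)"

lemma det_diag_real: "det (diag_real d) = of_real (\<Prod>i\<in>UNIV. d i)"
  by (subst det_diagonal) (simp_all add: diag_real_def)

lemma diag_real_add: "diag_real d + diag_real e = diag_real (\<lambda>i. d i + e i)"
  by (simp add: diag_real_def vec_eq_iff)

lemma diag_real_mult: "diag_real d ** diag_real e = diag_real (\<lambda>i. d i * e i)"
  by (auto simp: diag_real_def vec_eq_iff matrix_matrix_mult_def if_distrib[of "\<lambda>x. x * _"]
      cong: if_cong)

lemma diag_real_const: "diag_real (\<lambda>_. c) = c *\<^sub>R mat 1"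
  by (simp add: diag_real_def vec_eq_iff mat_def scaleR_conv_of_real[where 'a=complex])

lemma conj_transpose_diag_real: "conj_transpose (diag_real d) = diag_real d"
  by (auto simp: diag_real_def conj_transpose_def vec_eq_iff)

lemma unitary_sym:
  fixes U :: "complex^'n^'n"
  shows "conj_transpose U ** U = mat 1 \<longleftrightarrow> U ** conj_transpose U = mat 1"
  by (rule matrix_left_right_inverse)

lemma unitary_of_orthonormal:
  assumes "\<And>i j. cinner (u i) (u j) = (if i = j then 1 else 0)"
  shows "conj_transpose (\<chi> k i. u i $ k) ** (\<chi> k i. u i $ k) = mat 1"
  using assms by (simp add: conj_transpose_def matrix_matrix_mult_def mat_def vec_eq_iff cinner_def)

text \<open>With the eigenvectors as columns of \<open>U\<close>, the eigenvalue equations read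
  \<open>A ** U = U ** diag_real d\<close>.\<close>

theorem hermitian_spectral:
  fixes A :: "complex^'n^'n"
  assumes A: "hermitian_matrix A"
  obtains U :: "complex^'n^'n" and d where "conj_transpose U ** U = mat 1" "A = U ** diag_real d ** conj_transpose U"
proof -
  obtain u and d :: "'n \<Rightarrow> real"
    where u: "\<And>i. A *v u i = d i *\<^sub>R u i"
      and on: "\<And>i j. cinner (u i) (u j) = (if i = j then 1 else 0)"
    using hermitian_orthonormal_eigenvectors[OF A, of UNIV] by blast
  define U where "U = (\<chi> k i. u i $ k)"
  have U: "conj_transpose U ** U = mat 1"
    unfolding U_def by (rule unitary_of_orthonormal[OF on])
  have "(A ** U) $ k $ i = (U ** diag_real d) $ k $ i" for k i
  proof -
    have "(A ** U) $ k $ i = (A *v u i) $ k"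
      by (simp add: U_def matrix_matrix_mult_def matrix_vector_mult_def)
    also have "\<dots> = (U ** diag_real d) $ k $ i"
      by (simp add: u U_def matrix_matrix_mult_def diag_real_def if_distrib[of "\<lambda>x. _ * x"]
          scaleR_conv_of_real[where 'a=complex] mult.commute cong: if_cong)
    finally show ?thesis .
  qed
  then have "A ** U = U ** diag_real d" by (simp add: vec_eq_iff)
  then have "U ** diag_real d ** conj_transpose U = A ** (U ** conj_transpose U)"
    by (simp add: matrix_mul_assoc)
  then have "A = U ** diag_real d ** conj_transpose U"
    using U by (simp add: unitary_sym)
  with U that show ?thesis by blast
qed

text \<open>\<open>diag_real d\<close> is congruent to \<open>A\<close>, hence positive definite,
  and its quadratic form at the standard basis vectors is \<open>d i\<close>.\<close>

lemma pos_def_spectral: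
  fixes A :: "complex^'n^'n"
  assumes A: "A \<in> pos_def_matrices"
  obtains U :: "complex^'n^'n" and d where "conj_transpose U ** U = mat 1" "\<And>i. 0 < d i"
    "A = U ** diag_real d ** conj_transpose U"
proof -
  obtain U :: "complex^'n^'n" and d where U: "conj_transpose U ** U = mat 1"
    and AU: "A = U ** diag_real d ** conj_transpose U"
    using hermitian_spectral[OF pos_def_hermitian[OF A]] by blast
  have "conj_transpose U ** A ** U
      = (conj_transpose U ** U) ** diag_real d ** (conj_transpose U ** U)"
    by (simp only: AU matrix_mul_assoc)
  moreover have "invertible U" using U invertible_left_inverse by blast
  ultimately have D: "diag_real d \<in> pos_def_matrices"
    using pos_def_congruence[OF A, of U] by (simp add: U)
  have "0 < d i" for i
  proof -
    have "0 < axis i 1 \<bullet> (diag_real d *v axis i 1)"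
      using D by (simp add: pos_def_alt axis_eq_0_iff)
    also have "\<dots> = d i"
      by (simp add: inner_axis')
        (simp add: diag_real_def matrix_vector_mult_def axis_def
          if_distrib[of "\<lambda>x. _ * x"] cong: if_cong)
    finally show ?thesis .
  qed
  with U AU that show ?thesis by blast
qed

lemma det_unitary:
  fixes U :: "complex^'n^'n"
  assumes "conj_transpose U ** U = mat 1" shows "det U * det (conj_transpose U) = 1"
  using arg_cong[OF assms, of det] by (simp add: det_mul mult.commute)

lemma pos_def_det:
  fixes A :: "complex^'n^'n"
  assumes "A \<in> pos_def_matrices"
  shows "\<exists>r>0. det A = complex_of_real r"
proof -
  obtain U :: "complex^'n^'n" and d where U: "conj_transpose U ** U = mat 1" and d: "\<And>i. 0 < d i"
    and A: "A = U ** diag_real d ** conj_transpose U"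
    using pos_def_spectral[OF assms] by blast
  have "det A = (det U * det (conj_transpose U)) * det (diag_real d)"
    by (simp add: A det_mul)
  then have "det A = of_real (\<Prod>i\<in>UNIV. d i)"
    by (simp add: det_unitary[OF U] det_diag_real)
  then show ?thesis using d prod_pos by metis
qed

lemma pos_def_factor:
  fixes A :: "complex^'n^'n"
  assumes "A \<in> pos_def_matrices"
  obtains S :: "complex^'n^'n" where "invertible S" "A = conj_transpose S ** S"
proof -
  obtain U :: "complex^'n^'n" and d where U: "conj_transpose U ** U = mat 1" and d: "\<And>i. 0 < d i"
    and A: "A = U ** diag_real d ** conj_transpose U"
    using pos_def_spectral[OF assms] by blast
  \<comment> \<open>With the square root of the diagonal part, the product of
    \<open>conj_transpose S\<close> and \<open>S\<close> restores the spectral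
    decomposition.\<close>
  define S where "S = diag_real (\<lambda>i. sqrt (d i)) ** conj_transpose U"
  have "diag_real d = diag_real (\<lambda>i. sqrt (d i)) ** diag_real (\<lambda>i. sqrt (d i))"
    using d by (simp add: diag_real_mult less_imp_le)
  then have S: "A = conj_transpose S ** S"
    by (simp add: A S_def conj_transpose_mult conj_transpose_diag_real matrix_mul_assoc)
  moreover have "det S \<noteq> 0"
    using pos_def_det[OF assms] by (auto simp: S det_mul)
  ultimately show ?thesis using that invertible_det_nz by blast
qed

section \<open>From determinants to traces\<close>

lemma weighted_ln_inequality:
  fixes c d :: real
  assumes "c > 0" "d > 0"
  defines "g \<equiv> ln ((1 + d) / (1 + c)) - c / (1 + c) * ln (d / c)"
  shows "g \<ge> 0" "g = 0 \<Longrightarrow> d = c"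
proof -
  \<comment> \<open>\<open>m\<close> is the mean of the points 1 and \<open>d / c\<close> with
    weights \<open>1 / (1 + c)\<close> and \<open>c / (1 + c)\<close>, and \<open>g\<close> is the
    gap in Jensen's inequality for \<open>ln\<close> at these points.\<close>
  define m where "m = (1 + d) / (1 + c)"
  have m: "m > 0" using assms by (simp add: m_def)
  \<comment> \<open>The nonnegative function \<open>t - 1 - ln t\<close> at each point divided by
    the mean. By \<open>w\<close> these quotients average to 1, so the linear parts cancel and
    \<open>g\<close> is the weighted average of \<open>a\<close> and \<open>b\<close>.\<close>
  define a b where "a = 1 / m - 1 - ln (1 / m)" and "b = d / c / m - 1 - ln (d / c / m)"
  have a: "a \<ge> 0" and b: "b \<ge> 0"
    using ln_le_minus_one[of "1 / m"] ln_le_minus_one[of "d / c / m"] m assms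
    by (simp_all add: a_def b_def)
  have w: "1 / (1 + c) * (1 / m) + c / (1 + c) * (d / c / m) = 1"
  proof -
    have "c / (1 + c) * (d / c / m) = d / (1 + c) / m"
      using assms(1) by simp
    then have "1 / (1 + c) * (1 / m) + c / (1 + c) * (d / c / m) = (1 + d) / (1 + c) / m"
      by (simp only: add_divide_distrib) simp
    then show ?thesis using m by (simp add: m_def[symmetric])
  qed
  have p: "1 / (1 + c) + c / (1 + c) = 1" using assms(1,2) by (simp add: field_simps)
  have l: "ln (1 / m) = - ln m" "ln (d / c / m) = ln (d / c) - ln m"
    using assms(1,2) m by (simp_all add: ln_div ln_mult)
  have "1 / (1 + c) * a + c / (1 + c) * b
      = (1 / (1 + c) * (1 / m) + c / (1 + c) * (d / c / m)) - (1 / (1 + c) + c / (1 + c))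
        + (1 / (1 + c) + c / (1 + c)) * ln m - c / (1 + c) * ln (d / c)"
    unfolding a_def b_def l by (simp add: algebra_simps)
  then have g: "g = 1 / (1 + c) * a + c / (1 + c) * b"
    by (simp only: w p) (simp add: g_def m_def)
  have s: "1 / (1 + c) * a \<ge> 0" "c / (1 + c) * b \<ge> 0"
    using a b assms by simp_all
  then show "g \<ge> 0" by (simp add: g)
  assume "g = 0"
  then have "1 / (1 + c) * a = 0" using s g by linarith
  then have "a = 0" using assms by simp
  then have "1 / m = 1" using ln_eq_minus_one[of "1 / m"] m by (simp add: a_def)
  then show "d = c" using assms by (simp add: m_def field_simps)
qed

text \<open>The equality case for the pair \<open>mat 1\<close>, \<open>Q\<close>. In terms of the
  eigenvalues \<open>d i\<close>, the two determinant hypotheses make both sums of logarithms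
  vanish; so the nonnegative Jensen gaps \<open>g i\<close> sum to zero, and each of them
  vanishes.\<close>

lemma det_one_plus_eq_imp_scalar:
  fixes Q :: "complex^'n^'n"
  assumes Q: "Q \<in> pos_def_matrices" and c: "c > 0"
    and det: "det Q = of_real (c ^ CARD('n))"
    and det1: "det (mat 1 + Q) = of_real ((1 + c) ^ CARD('n))"
  shows "Q = c *\<^sub>R mat 1"
proof -
  obtain U :: "complex^'n^'n" and d where U: "conj_transpose U ** U = mat 1"
    and d: "\<And>i. 0 < d i" and QU: "Q = U ** diag_real d ** conj_transpose U"
    using pos_def_spectral[OF Q] by blast
  have UU: "U ** conj_transpose U = mat 1" using U unitary_sym by blast
  have "mat 1 + Q = U ** (diag_real (\<lambda>_. 1) + diag_real d) ** conj_transpose U"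
    by (simp add: QU diag_real_const matrix_ring_simps UU)
  then have Q1: "mat 1 + Q = U ** diag_real (\<lambda>i. 1 + d i) ** conj_transpose U"
    by (simp add: diag_real_add)
  have det_conj: "det (U ** D ** conj_transpose U) = det D" for D
    using det_unitary[OF U] by (simp add: det_mul mult_ac)
  have p: "(\<Prod>i\<in>UNIV. d i) = c ^ CARD('n)"
    using det unfolding QU det_conj det_diag_real of_real_eq_iff .
  have p1: "(\<Prod>i\<in>UNIV. 1 + d i) = (1 + c) ^ CARD('n)"
    using det1 unfolding Q1 det_conj det_diag_real of_real_eq_iff .
  have d0: "d i \<noteq> 0" and d1: "1 + d i \<noteq> 0" for i using d[of i] by linarith+
  define g where "g i = ln ((1 + d i) / (1 + c)) - c / (1 + c) * ln (d i / c)" for i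
  have "(\<Sum>i\<in>UNIV. ln ((1 + d i) / (1 + c))) = ln (\<Prod>i\<in>UNIV. (1 + d i) / (1 + c))"
    using d1 c by (subst ln_prod) auto
  also have "\<dots> = 0" using c by (simp add: prod_dividef p1)
  finally have s1: "(\<Sum>i\<in>UNIV. ln ((1 + d i) / (1 + c))) = 0" .
  have "(\<Sum>i\<in>UNIV. ln (d i / c)) = ln (\<Prod>i\<in>UNIV. d i / c)"
    using d0 c by (subst ln_prod) auto
  also have "\<dots> = 0" using c by (simp add: prod_dividef p)
  finally have s2: "(\<Sum>i\<in>UNIV. ln (d i / c)) = 0" .
  have "(\<Sum>i\<in>UNIV. g i) = 0"
    unfolding g_def sum_subtractf sum_distrib_left[symmetric] s1 s2 by simp
  then have "g i = 0" for i
    using weighted_ln_inequality(1)[OF c d]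
    by (subst (asm) sum_nonneg_eq_0_iff) (auto simp: g_def)
  then have "d i = c" for i
    using weighted_ln_inequality(2)[OF c d] by (auto simp: g_def)
  then have "d = (\<lambda>_. c)" by auto
  then show ?thesis by (simp add: QU diag_real_const matrix_ring_simps UU)
qed

text \<open>Congruence by the inverse of a factor of \<open>P\<close> carries \<open>P\<close> to
  the identity and multiplies all determinants by the same number, which reduces the claim to the
  case \<open>P = mat 1\<close>.\<close>

lemma pos_def_minkowski_eq:
  fixes P Q :: "complex^'n^'n"
  assumes P: "P \<in> pos_def_matrices" and Q: "Q \<in> pos_def_matrices" and c: "c > 0"
    and det: "det Q = of_real (c ^ CARD('n)) * det P"
    and det1: "det (P + Q) = of_real ((1 + c) ^ CARD('n)) * det P"
  shows "Q = c *\<^sub>R P"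
proof -
  obtain S :: "complex^'n^'n" where S: "invertible S" and PS: "P = conj_transpose S ** S"
    using pos_def_factor[OF P] by blast
  define T where "T = matrix_inv S"
  have T: "invertible T" "S ** T = mat 1" "T ** S = mat 1"
    using invertible_matrix_inv[OF S] matrix_inv_mult[OF S] by (simp_all add: T_def)
  have T': "conj_transpose T ** conj_transpose S = mat 1"
    "conj_transpose S ** conj_transpose T = mat 1"
    by (simp_all add: conj_transpose_mult[symmetric] T)
  define R where "R = conj_transpose T ** Q ** T"
  have PT: "conj_transpose T ** P ** T = mat 1"
  proof -
    have "conj_transpose T ** P ** T = (conj_transpose T ** conj_transpose S) ** (S ** T)"
      by (simp only: PS matrix_mul_assoc)
    then show ?thesis by (simp add: T T')
  qed
  have dT: "det (conj_transpose T) * det P * det T = 1"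
    using arg_cong[OF PT, of det] by (simp add: det_mul)
  have "R = c *\<^sub>R mat 1"
  proof (rule det_one_plus_eq_imp_scalar[OF _ c])
    show "R \<in> pos_def_matrices"
      unfolding R_def by (rule pos_def_congruence[OF Q T(1)])
    have "det R = of_real (c ^ CARD('n)) * (det (conj_transpose T) * det P * det T)"
      by (simp add: R_def det_mul det)
    then show "det R = of_real (c ^ CARD('n))" by (simp add: dT)
    have "mat 1 + R = conj_transpose T ** (P + Q) ** T"
      by (simp add: R_def PT matrix_ring_simps)
    then have "det (mat 1 + R)
        = of_real ((1 + c) ^ CARD('n)) * (det (conj_transpose T) * det P * det T)"
      by (simp add: det_mul det1)
    then show "det (mat 1 + R) = of_real ((1 + c) ^ CARD('n))" by (simp add: dT)
  qed
  have "Q = (conj_transpose S ** conj_transpose T) ** Q ** (T ** S)"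
    by (simp add: T T')
  also have "\<dots> = conj_transpose S ** R ** S"
    by (simp only: R_def matrix_mul_assoc)
  also have "\<dots> = c *\<^sub>R P"
    by (simp add: \<open>R = c *\<^sub>R mat 1\<close> matrix_ring_simps PS)
  finally show ?thesis .
qed

section \<open>First-order expansion of the determinant at the identity\<close>

lemma det_one_plus_has_field_derivative:
  fixes X :: "complex^'n^'n"
  shows "((\<lambda>s. det (\<chi> i j. mat 1 $ i $ j + s * X $ i $ j)) has_field_derivative trace X) (at 0)"
proof -
  let ?f = "\<lambda>i j s. mat 1 $ i $ j + s * X $ i $ j"
  have "((\<lambda>s. \<Prod>i\<in>UNIV. ?f i (p i) s) has_field_derivative
      (\<Sum>i\<in>UNIV. X $ i $ p i * (\<Prod>j\<in>UNIV - {i}. ?f j (p j) 0))) (at 0)" for p :: "'n \<Rightarrow> 'n"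
    by (rule has_field_derivative_prod) (auto intro!: derivative_eq_intros)
  then have "((\<lambda>s. \<Sum>p\<in>{p. p permutes UNIV}. of_int (sign p) * (\<Prod>i\<in>UNIV. ?f i (p i) s))
      has_field_derivative (\<Sum>p\<in>{p. p permutes UNIV}. of_int (sign p) *
      (\<Sum>i\<in>UNIV. X $ i $ p i * (\<Prod>j\<in>UNIV - {i}. ?f j (p j) 0)))) (at 0)"
    by (intro DERIV_sum DERIV_cmult)
  moreover have "(\<Sum>p\<in>{p. p permutes UNIV}. of_int (sign p) *
      (\<Sum>i\<in>UNIV. X $ i $ p i * (\<Prod>j\<in>UNIV - {i}. ?f j (p j) 0)))
    = (\<Sum>p\<in>{id}. of_int (sign p) *
      (\<Sum>i\<in>UNIV. X $ i $ p i * (\<Prod>j\<in>UNIV - {i}. ?f j (p j) 0)))"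
  proof (rule sum.mono_neutral_right)
    show "\<forall>p\<in>{p. p permutes UNIV} - {id}. of_int (sign p) *
      (\<Sum>i\<in>UNIV. X $ i $ p i * (\<Prod>j\<in>UNIV - {i}. ?f j (p j) 0)) = 0"
    proof
      fix p :: "'n \<Rightarrow> 'n" assume p: "p \<in> {p. p permutes UNIV} - {id}"
      have pz: "(\<Prod>j\<in>UNIV - {i}. ?f j (p j) 0) = 0" for i
      proof -
        \<comment> \<open>A permutation other than \<open>id\<close> moves at least two points,
          \<open>k\<close> and \<open>p k\<close>. After removal of the differentiated factor
          \<open>i\<close> an off-diagonal entry of the identity remains, so only \<open>id\<close>
          contributes to the Leibniz sum.\<close>
        obtain k where k: "p k \<noteq> k" using p by fastforce
        have "inj p" using p permutes_inj by blast
        then have "p (p k) \<noteq> p k" using k by (simp add: inj_eq)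
        with k obtain j where "j \<noteq> i" "p j \<noteq> j" by metis
        then show ?thesis by (auto simp: mat_def intro!: prod_zero bexI[of _ j])
      qed
      then show "of_int (sign p) *
        (\<Sum>i\<in>UNIV. X $ i $ p i * (\<Prod>j\<in>UNIV - {i}. ?f j (p j) 0)) = 0"
        by (simp only: pz mult_zero_right sum.neutral_const)
    qed
  qed (auto simp: finite_permutations permutes_id)
  ultimately show ?thesis
    by (simp add: det_def trace_def mat_def)
qed

text \<open>Each trace is the derivative at 0 of its determinant. Since agreement is assumed for
  positive \<open>s\<close>, the derivatives are compared along the sequence
  \<open>1 / Suc n\<close>.\<close>

lemma trace_eq_if_det_one_plus_eq:
  fixes X Y :: "complex^'n^'n"
  assumes "\<And>s::real. s > 0 \<Longrightarrow> det (mat 1 + s *\<^sub>R X) = det (mat 1 + s *\<^sub>R Y)"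
  shows "trace X = trace Y"
proof -
  define f where "f X s = det (\<chi> i j. mat 1 $ i $ j + s * X $ i $ j)" for X :: "complex^'n^'n" and s
  have f0: "f X 0 = 1" for X
    using det_I[where 'n='n and 'a=complex] by (simp add: f_def mat_def)
  have f: "f X (of_real s) = det (mat 1 + s *\<^sub>R X)" for X s
    unfolding f_def
    by (rule arg_cong[of _ _ det]) (simp add: vec_eq_iff scaleR_conv_of_real[where 'a=complex])
  have lim: "(\<lambda>n. (f X (of_real (1 / Suc n)) - 1) / of_real (1 / Suc n)) \<longlonglongrightarrow> trace X" for X
  proof -
    have D: "((\<lambda>h. (f X (0 + h) - f X 0) / h) \<longlongrightarrow> trace X) (at 0)"
      using det_one_plus_has_field_derivative[of X] unfolding f_def[symmetric] by (rule DERIV_D)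
    have L: "filterlim (\<lambda>n. complex_of_real (1 / Suc n)) (at 0) sequentially"
    proof (rule filterlim_atI)
      show "(\<lambda>n. complex_of_real (1 / Suc n)) \<longlonglongrightarrow> 0"
        using tendsto_of_real[OF LIMSEQ_inverse_real_of_nat, where 'a=complex]
        by (simp add: inverse_eq_divide)
    qed (simp del: of_nat_Suc)
    show ?thesis using filterlim_compose[OF D L] by (simp only: f0 add_0_left)
  qed
  have "f X (of_real (1 / Suc n)) = f Y (of_real (1 / Suc n))" for n
    unfolding f by (rule assms) simp
  then show ?thesis using LIMSEQ_unique[OF lim[of X]] lim[of Y] by simp
qed

lemma det_preserving_imp_trace_preserving:
  fixes \<phi> :: "complex^'n^'n \<Rightarrow> complex^'n^'n" and k :: complex
  assumes maps: "\<And>A. A \<in> pos_def_matrices \<Longrightarrow> \<phi> A \<in> pos_def_matrices"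
    and det: "\<And>A B. A \<in> pos_def_matrices \<Longrightarrow> B \<in> pos_def_matrices \<Longrightarrow>
      det (\<phi> A + \<phi> B) = k * det (A + B)"
    and A: "A \<in> pos_def_matrices" and B: "B \<in> pos_def_matrices"
  shows "trace (\<phi> A ** matrix_inv (\<phi> B)) = trace (A ** matrix_inv B)"
proof -
  \<comment> \<open>Both arguments are taken to be \<open>X\<close>; the power of 2 cancels.\<close>
  have det1: "det (\<phi> X) = k * det X" if "X \<in> pos_def_matrices" for X
  proof -
    have "det (2 *\<^sub>R \<phi> X) = k * det (2 *\<^sub>R X)"
      using det[OF that that] by (simp add: scaleR_2)
    then show ?thesis by (simp add: det_scaleR)
  qed
  \<comment> \<open>Up to the common factor \<open>k\<close>, the determinants of
    \<open>\<phi> X\<close>, \<open>\<phi> (c *\<^sub>R X)\<close> and their sum are those for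
    \<open>X\<close> and \<open>c *\<^sub>R X\<close>, so the equality case of Minkowski's
    inequality applies.\<close>
  have hom: "\<phi> (c *\<^sub>R X) = c *\<^sub>R \<phi> X" if X: "X \<in> pos_def_matrices" and c: "c > 0" for X c
  proof (rule pos_def_minkowski_eq[OF maps[OF X] maps[OF pos_def_scaleR[OF X c]] c])
    show "det (\<phi> (c *\<^sub>R X)) = of_real (c ^ CARD('n)) * det (\<phi> X)"
      by (simp add: det1 pos_def_scaleR X c det_scaleR)
    have "X + c *\<^sub>R X = (1 + c) *\<^sub>R X" by (simp add: scaleR_add_left)
    then show "det (\<phi> X + \<phi> (c *\<^sub>R X)) = of_real ((1 + c) ^ CARD('n)) * det (\<phi> X)"
      by (simp add: det1 det X pos_def_scaleR c det_scaleR)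
  qed
  \<comment> \<open>Right multiplication by \<open>Y\<close> clears the inverse and leaves the
    determinant of a sum, the form that \<open>det\<close> speaks about.\<close>
  have fac: "det (mat 1 + s *\<^sub>R (X ** matrix_inv Y)) * det Y = det (Y + s *\<^sub>R X)"
    if "Y \<in> pos_def_matrices" for X Y :: "complex^'n^'n" and s
  proof -
    note inv = matrix_inv_mult[OF pos_def_invertible[OF that]]
    have "(mat 1 + s *\<^sub>R (X ** matrix_inv Y)) ** Y = Y + s *\<^sub>R (X ** (matrix_inv Y ** Y))"
      by (simp only: matrix_ring_simps matrix_mul_assoc matrix_mul_lid)
    then show ?thesis by (simp add: inv det_mul[symmetric])
  qed
  show ?thesis
  proof (rule trace_eq_if_det_one_plus_eq)
    fix s :: real assume s: "s > 0"
    have "det (mat 1 + s *\<^sub>R (\<phi> A ** matrix_inv (\<phi> B))) * det (\<phi> B) = k * det (B + s *\<^sub>R A)"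
      using fac[OF maps[OF B]] det[OF B pos_def_scaleR[OF A s]] by (simp add: hom[OF A s])
    also have "\<dots> = det (mat 1 + s *\<^sub>R (A ** matrix_inv B)) * det (\<phi> B)"
      by (simp add: fac[OF B, symmetric] det1[OF B])
    finally show "det (mat 1 + s *\<^sub>R (\<phi> A ** matrix_inv (\<phi> B)))
        = det (mat 1 + s *\<^sub>R (A ** matrix_inv B))"
      using pos_def_det[OF maps[OF B]] by auto
  qed
qed

section \<open>From traces to Jordan maps\<close>

lemma orthogonal_to_span_eq_0:
  fixes v :: "'a::real_inner"
  assumes "v \<in> span T" "\<And>w. w \<in> T \<Longrightarrow> v \<bullet> w = 0"
  shows "v = 0"
proof -
  have "span T \<subseteq> {w. v \<bullet> w = 0}"
    using assms(2) by (intro span_minimal subspace_hyperplane) blast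
  then have "v \<bullet> v = 0" using assms(1) by blast
  then show ?thesis by simp
qed

text \<open>\<open>F\<close> extends \<open>f\<close> linearly from a basis of \<open>span S\<close>
  chosen inside \<open>S\<close>, so here it is known to agree with \<open>f\<close> on
  \<open>B\<close> only. The pairing with \<open>g\<close> survives by linearity and forces
  injectivity: \<open>F v = 0\<close> makes \<open>v\<close> orthogonal to all of
  \<open>S\<close>.\<close>

lemma inner_duality_basis:
  fixes f g :: "'a::euclidean_space \<Rightarrow> 'a"
  assumes f: "f \<in> S \<rightarrow> span S"
    and fg: "\<And>a c. a \<in> S \<Longrightarrow> c \<in> S \<Longrightarrow> f a \<bullet> g c = a \<bullet> c"
  obtains F B where "linear F" "B \<subseteq> S" "independent B" "card B = dim S"
    "\<And>b. b \<in> B \<Longrightarrow> F b = f b" "F ` span S \<subseteq> span S" "inj_on F (span S)"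
    "\<And>v c. v \<in> span S \<Longrightarrow> c \<in> S \<Longrightarrow> F v \<bullet> g c = v \<bullet> c"
proof -
  obtain B where B: "B \<subseteq> S" "independent B" "S \<subseteq> span B" "card B = dim S"
    using basis_exists[of S] by blast
  obtain F where lin: "linear F" and F: "\<And>b. b \<in> B \<Longrightarrow> F b = f b"
    using linear_independent_extend[OF B(2), of f] by blast
  have spB: "span B = span S"
    using B(1,3) by (intro antisym span_mono span_minimal) auto
  have "F ` span B = span (F ` B)" by (rule linear_span_image[OF lin, symmetric])
  also have "\<dots> \<subseteq> span S" using F f B(1) by (intro span_minimal) auto
  finally have Fspan: "F ` span S \<subseteq> span S" by (simp add: spB)
  have Fg: "F v \<bullet> g c = v \<bullet> c" if v: "v \<in> span S" and c: "c \<in> S" for v c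
  proof -
    have "subspace {v. F v \<bullet> g c = v \<bullet> c}"
      by (simp add: subspace_def linear_0[OF lin] linear_add[OF lin] linear_scale[OF lin]
          inner_left_distrib)
    then have "span B \<subseteq> {v. F v \<bullet> g c = v \<bullet> c}"
      using F fg B(1) c by (intro span_minimal) auto
    then show ?thesis using v spB by blast
  qed
  have "v = 0" if "v \<in> span S" "F v = 0" for v
    using that(1)
  proof (rule orthogonal_to_span_eq_0)
    show "v \<bullet> w = 0" if "w \<in> S" for w
      using Fg[OF \<open>v \<in> span S\<close> that] \<open>F v = 0\<close> by simp
  qed
  then have "inj_on F (span S)"
    using linear_inj_on_iff_eq_0[OF lin subspace_span] by blast
  from that[OF lin B(1,2,4) F Fspan this Fg] show ?thesis .
qed

lemma inner_duality_span:
  fixes f g :: "'a::euclidean_space \<Rightarrow> 'a"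
  assumes f: "f \<in> S \<rightarrow> span S"
    and fg: "\<And>a c. a \<in> S \<Longrightarrow> c \<in> S \<Longrightarrow> f a \<bullet> g c = a \<bullet> c"
  shows "span (f ` S) = span S"
proof -
  obtain F B where lin: "linear F" and B: "B \<subseteq> S" "independent B" "card B = dim S"
    and F: "\<And>b. b \<in> B \<Longrightarrow> F b = f b" and inj: "inj_on F (span S)"
    using inner_duality_basis[OF f fg] by metis
  have "span B \<subseteq> span S" using B(1) by (rule span_mono)
  then have inj: "inj_on F (span B)" by (rule inj_on_subset[OF inj])
  have "independent (F ` B)"
    using linear_independent_injective_image[OF lin B(2) inj] .
  moreover have "card (F ` B) = dim (span S)"
    using card_image[OF inj_on_subset[OF inj span_superset]] B(3) by simp
  moreover have FB: "F ` B \<subseteq> f ` S" using F B(1) by auto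
  moreover have "f ` S \<subseteq> span S" using f by auto
  ultimately have "span S \<subseteq> span (F ` B)"
    using card_ge_dim_independent[of "F ` B" "span S"] by auto
  also have "\<dots> \<subseteq> span (f ` S)" by (rule span_mono[OF FB])
  finally show ?thesis
    using span_minimal[OF \<open>f ` S \<subseteq> span S\<close> subspace_span] by blast
qed

text \<open>The span lemma with the roles of \<open>f\<close> and \<open>g\<close> exchanged shows
  that the values of \<open>g\<close> span \<open>span S\<close>. The difference
  \<open>F a - f a\<close> lies in that span and is orthogonal to every value of \<open>g\<close>,
  hence is zero.\<close>

lemma inner_duality_linear_extension:
  fixes f g :: "'a::euclidean_space \<Rightarrow> 'a"
  assumes f: "f \<in> S \<rightarrow> span S" and g: "g \<in> S \<rightarrow> span S"
    and fg: "\<And>a c. a \<in> S \<Longrightarrow> c \<in> S \<Longrightarrow> f a \<bullet> g c = a \<bullet> c"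
  obtains F where "linear F" "\<And>a. a \<in> S \<Longrightarrow> F a = f a" "F ` span S \<subseteq> span S"
    "inj_on F (span S)"
proof -
  obtain F B where lin: "linear F" and Fspan: "F ` span S \<subseteq> span S" and inj: "inj_on F (span S)"
    and Fg: "\<And>v c. v \<in> span S \<Longrightarrow> c \<in> S \<Longrightarrow> F v \<bullet> g c = v \<bullet> c"
    using inner_duality_basis[OF f fg] by metis
  have gS: "span (g ` S) = span S"
    by (rule inner_duality_span[OF g, of f]) (metis fg inner_commute)
  have "F a = f a" if a: "a \<in> S" for a
  proof -
    have "F a \<in> span S" "f a \<in> span S" using Fspan f a span_base[OF a] by auto
    then have "F a - f a \<in> span (g ` S)" by (simp add: gS span_diff)
    then have "F a - f a = 0"
    proof (rule orthogonal_to_span_eq_0)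
      show "(F a - f a) \<bullet> w = 0" if "w \<in> g ` S" for w
        using that a Fg[OF span_base[OF a]] fg[OF a] by (auto simp: inner_diff_left)
    qed
    then show ?thesis by simp
  qed
  then show ?thesis using that lin Fspan inj by blast
qed

section \<open>Hermitian matrices as the real span of the positive definite ones\<close>

lemma subspace_hermitian: "subspace {X. hermitian_matrix X}"
  by (simp add: subspace_def hermitian_matrix_def conj_transpose_add conj_transpose_scaleR)
    (simp add: conj_transpose_def vec_eq_iff)

lemma hermitian_one_plus_pos_def:
  fixes X :: "complex^'n^'n"
  assumes X: "hermitian_matrix X" and less: "\<And>x. x \<noteq> 0 \<Longrightarrow> norm (X *v x) < norm x"
  shows "mat 1 + X \<in> pos_def_matrices"
proof -
  have "0 < x \<bullet> ((mat 1 + X) *v x)" if "x \<noteq> 0" for x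
  proof -
    have "\<bar>x \<bullet> (X *v x)\<bar> \<le> norm x * norm (X *v x)" by (rule Cauchy_Schwarz_ineq2)
    also have "\<dots> < norm x * norm x" using less[OF that] that by simp
    also have "\<dots> = x \<bullet> x" by (simp add: dot_square_norm power2_eq_square)
    finally show ?thesis by (simp add: matrix_vector_mult_add_rdistrib inner_right_distrib)
  qed
  then show ?thesis
    using X by (simp add: pos_def_alt hermitian_matrix_def conj_transpose_add)
qed

lemma hermitian_small_multiple:
  fixes X :: "complex^'n^'n"
  obtains c where "c > 0" "\<And>x. x \<noteq> 0 \<Longrightarrow> norm ((c *\<^sub>R X) *v x) < norm x"
proof -
  have "bounded_linear (\<lambda>x. X *v x)"
    by (simp add: linear_linear)
  then obtain K where K: "K > 0" "\<And>x. norm (X *v x) \<le> norm x * K"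
    using bounded_linear.pos_bounded by blast
  \<comment> \<open>Dividing by \<open>K + 1\<close> instead of \<open>K\<close> makes the
    contraction strict.\<close>
  have "norm ((1 / (K + 1)) *\<^sub>R X *v x) < norm x" if "x \<noteq> 0" for x
  proof -
    have "norm (X *v x) < norm x * (K + 1)"
      using K(2)[of x] that by (simp add: algebra_simps) (smt (verit) zero_less_norm_iff)
    then show ?thesis using K(1) by (simp add: matrix_scaleR_vector field_simps)
  qed
  then show ?thesis using K(1) that[of "1 / (K + 1)"] by simp
qed

text \<open>For small \<open>c\<close> the matrix \<open>mat 1 + c *\<^sub>R X\<close> is positive
  definite, and \<open>X\<close> is a combination of it and \<open>mat 1\<close>.\<close>

lemma span_pos_def: "span pos_def_matrices = {X :: complex^'n^'n. hermitian_matrix X}"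
proof (rule antisym)
  show "span pos_def_matrices \<subseteq> {X :: complex^'n^'n. hermitian_matrix X}"
    by (intro span_minimal subspace_hermitian) (auto simp: pos_def_hermitian)
  show "{X :: complex^'n^'n. hermitian_matrix X} \<subseteq> span pos_def_matrices"
  proof
    fix X :: "complex^'n^'n" assume "X \<in> {X. hermitian_matrix X}"
    then have X: "hermitian_matrix X" by simp
    obtain c where c: "c > 0" "\<And>x. x \<noteq> 0 \<Longrightarrow> norm ((c *\<^sub>R X) *v x) < norm x"
      using hermitian_small_multiple by blast
    have "mat 1 + c *\<^sub>R X \<in> pos_def_matrices"
      using X c(2)
      by (intro hermitian_one_plus_pos_def) (simp_all add: hermitian_matrix_def conj_transpose_scaleR)
    then have "(1 / c) *\<^sub>R ((mat 1 + c *\<^sub>R X) - mat 1) \<in> span pos_def_matrices"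
      by (intro span_scale span_diff span_base pos_def_mat_1)
    then show "X \<in> span pos_def_matrices" using c(1) by simp
  qed
qed

text \<open>Turns the behaviour of a map on inverses into its behaviour on squares without a limiting
  process.\<close>

lemma matrix_inv_partial_fractions:
  fixes Y :: "complex^'n^'n"
  assumes "invertible (mat 1 + Y)" "invertible (mat 1 - Y)"
  shows "invertible (mat 1 - Y ** Y)"
    "matrix_inv (mat 1 + Y) + matrix_inv (mat 1 - Y) = 2 *\<^sub>R matrix_inv (mat 1 - Y ** Y)"
proof -
  let ?p = "mat 1 + Y" and ?m = "mat 1 - Y"
  have f: "mat 1 - Y ** Y = ?m ** ?p" "mat 1 - Y ** Y = ?p ** ?m"
    by (simp_all add: matrix_ring_simps)
  show "invertible (mat 1 - Y ** Y)"
    unfolding f(1) using assms by (intro invertible_mult)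
  have 1: "(mat 1 - Y ** Y) ** matrix_inv ?p = ?m"
    unfolding f(1) by (simp add: matrix_mul_assoc[symmetric] matrix_inv_mult assms)
  have 2: "(mat 1 - Y ** Y) ** matrix_inv ?m = ?p"
    unfolding f(2) by (simp add: matrix_mul_assoc[symmetric] matrix_inv_mult assms)
  have "(mat 1 - Y ** Y) ** ((1/2) *\<^sub>R (matrix_inv ?p + matrix_inv ?m)) = (1/2) *\<^sub>R (?m + ?p)"
    by (simp only: matrix_scalar_ac scaleR_add_right scalar_matrix_assoc[symmetric] matrix_add_ldistrib 1 2)
  also have "\<dots> = mat 1" by (simp add: scaleR_2[symmetric])
  finally have "matrix_inv (mat 1 - Y ** Y) = (1/2) *\<^sub>R (matrix_inv ?p + matrix_inv ?m)"
    by (rule matrix_inv_eq)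
  then show "matrix_inv ?p + matrix_inv ?m = 2 *\<^sub>R matrix_inv (mat 1 - Y ** Y)" by simp
qed

text \<open>Linearity comes from the duality of \<open>\<psi>\<close> and \<open>\<eta>\<close>,
  squares from \<open>matrix_inv_partial_fractions\<close>. The injectivity clause will keep the
  images of the diagonal matrix units nonzero.\<close>

lemma unital_trace_preserving_imp_jordan:
  fixes \<psi> :: "complex^'n^'n \<Rightarrow> complex^'n^'n"
  assumes maps: "\<And>A. A \<in> pos_def_matrices \<Longrightarrow> \<psi> A \<in> pos_def_matrices"
    and one: "\<psi> (mat 1) = mat 1"
    and tr: "\<And>A B. A \<in> pos_def_matrices \<Longrightarrow> B \<in> pos_def_matrices \<Longrightarrow>
      trace (\<psi> A ** matrix_inv (\<psi> B)) = trace (A ** matrix_inv B)"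
  shows "\<exists>F. linear F \<and> (\<forall>A\<in>pos_def_matrices. F A = \<psi> A) \<and>
    (\<forall>X. hermitian_matrix X \<longrightarrow>
      hermitian_matrix (F X) \<and> (F X = 0 \<longrightarrow> X = 0) \<and> F (X ** X) = F X ** F X)"
proof -
  let ?P = "pos_def_matrices :: (complex^'n^'n) set"
  \<comment> \<open>Conjugating \<open>\<psi>\<close> with inversion removes the inverse from the
    trace condition, which then says that \<open>\<psi>\<close> and \<open>\<eta>\<close> preserve
    the inner product jointly.\<close>
  define \<eta> where "\<eta> C = matrix_inv (\<psi> (matrix_inv C))" for C
  have duality: "\<psi> A \<bullet> \<eta> C = A \<bullet> C" if "A \<in> ?P" "C \<in> ?P" for A C
  proof -
    have "\<psi> A \<bullet> \<eta> C = Re (trace (\<psi> A ** \<eta> C))"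
      by (simp add: hermitian_trace_inner pos_def_hermitian maps that)
    also have "\<dots> = Re (trace (A ** C))"
      unfolding \<eta>_def
      by (simp add: tr that pos_def_inverse invertible_matrix_inv(2) pos_def_invertible)
    also have "\<dots> = A \<bullet> C" by (simp add: hermitian_trace_inner pos_def_hermitian that)
    finally show ?thesis .
  qed
  have \<psi>S: "\<psi> \<in> ?P \<rightarrow> span ?P" and \<eta>S: "\<eta> \<in> ?P \<rightarrow> span ?P"
    by (auto simp: \<eta>_def intro!: span_base maps pos_def_inverse)
  obtain F where F: "linear F" "\<And>A. A \<in> ?P \<Longrightarrow> F A = \<psi> A" "F ` span ?P \<subseteq> span ?P"
    "inj_on F (span ?P)"
    using inner_duality_linear_extension[OF \<psi>S \<eta>S duality] by blast
  obtain G where G: "linear G" "\<And>A. A \<in> ?P \<Longrightarrow> G A = \<eta> A"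
    using inner_duality_linear_extension[OF \<eta>S \<psi>S] duality
    by (metis inner_commute)
  have G_inv: "G (matrix_inv A) = matrix_inv (\<psi> A)" if "A \<in> ?P" for A
    using that by (simp add: G pos_def_inverse \<eta>_def invertible_matrix_inv(2) pos_def_invertible)
  have F1: "F (mat 1) = mat 1" by (simp add: F(2) pos_def_mat_1 one)
  \<comment> \<open>For a strict contraction \<open>Y\<close> all of \<open>mat 1 + Y\<close>,
    \<open>mat 1 - Y\<close> and \<open>mat 1 - Y ** Y\<close> are positive definite, so
    \<open>F\<close> coincides with \<open>\<psi>\<close> on them.\<close>
  have sq: "F (Y ** Y) = F Y ** F Y"
    if Y: "hermitian_matrix Y" and less: "\<And>x. x \<noteq> 0 \<Longrightarrow> norm (Y *v x) < norm x" for Y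
  proof -
    have p: "mat 1 + Y \<in> ?P" using Y less by (rule hermitian_one_plus_pos_def)
    have "mat 1 + (- Y) \<in> ?P"
      using Y less
      by (intro hermitian_one_plus_pos_def)
        (simp_all add: hermitian_matrix_def conj_transpose_minus matrix_vector_minus)
    then have m: "mat 1 - Y \<in> ?P" by simp
    have "norm (Y *v (Y *v x)) < norm x" if "x \<noteq> 0" for x
      using less[OF that] less[of "Y *v x"] that by (cases "Y *v x = 0") auto
    then have "mat 1 + (- (Y ** Y)) \<in> ?P"
      using Y
      by (intro hermitian_one_plus_pos_def)
        (simp_all add: hermitian_matrix_def conj_transpose_minus conj_transpose_mult
          matrix_vector_minus matrix_vector_mul_assoc)
    then have q: "mat 1 - Y ** Y \<in> ?P" by simp
    have \<psi>p: "\<psi> (mat 1 + Y) = mat 1 + F Y" "\<psi> (mat 1 - Y) = mat 1 - F Y"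
      "\<psi> (mat 1 - Y ** Y) = mat 1 - F (Y ** Y)"
      using F(2)[OF p] F(2)[OF m] F(2)[OF q]
      by (simp_all add: linear_add[OF F(1)] linear_diff[OF F(1)] F1)
    note inv = pos_def_invertible[OF maps[OF p], unfolded \<psi>p]
      pos_def_invertible[OF maps[OF m], unfolded \<psi>p] pos_def_invertible[OF maps[OF q], unfolded \<psi>p]
    note pf = matrix_inv_partial_fractions[OF inv(1,2)]
    \<comment> \<open>The partial fraction identity is used for \<open>F Y\<close>, then for
      \<open>Y\<close> underneath the linear map \<open>G\<close>, which sends the inverse of
      \<open>A\<close> to the inverse of \<open>\<psi> A\<close>.\<close>
    have "2 *\<^sub>R matrix_inv (mat 1 - F Y ** F Y)
        = matrix_inv (mat 1 + F Y) + matrix_inv (mat 1 - F Y)"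
      by (rule pf(2)[symmetric])
    also have "\<dots> = G (matrix_inv (mat 1 + Y)) + G (matrix_inv (mat 1 - Y))"
      by (simp add: G_inv p m \<psi>p)
    also have "\<dots> = G (2 *\<^sub>R matrix_inv (mat 1 - Y ** Y))"
      by (simp add: linear_add[OF G(1), symmetric] matrix_inv_partial_fractions pos_def_invertible p m)
    also have "\<dots> = 2 *\<^sub>R matrix_inv (mat 1 - F (Y ** Y))"
      by (simp add: linear_scale[OF G(1)] G_inv q \<psi>p)
    finally have "matrix_inv (mat 1 - F Y ** F Y) = matrix_inv (mat 1 - F (Y ** Y))" by simp
    then have "mat 1 - F Y ** F Y = mat 1 - F (Y ** Y)"
      using invertible_matrix_inv(2)[OF pf(1)] invertible_matrix_inv(2)[OF inv(3)] by metis
    then show ?thesis by simp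
  qed
  \<comment> \<open>Both sides are homogeneous of degree two, so \<open>X\<close> may be shrunk to a
    strict contraction.\<close>
  have "F (X ** X) = F X ** F X" if X: "hermitian_matrix X" for X
  proof -
    obtain c where c: "c > 0" "\<And>x. x \<noteq> 0 \<Longrightarrow> norm ((c *\<^sub>R X) *v x) < norm x"
      using hermitian_small_multiple by blast
    have "hermitian_matrix (c *\<^sub>R X)"
      using X by (simp add: hermitian_matrix_def conj_transpose_scaleR)
    from sq[OF this c(2)] c(1) show ?thesis
      by (simp add: linear_scale[OF F(1)] matrix_ring_simps)
  qed
  moreover have "hermitian_matrix (F X)" if "hermitian_matrix X" for X
    using F(3) that unfolding span_pos_def by blast
  moreover have "X = 0" if "hermitian_matrix X" "F X = 0" for X
    using F(4) that linear_inj_on_iff_eq_0[OF F(1) subspace_hermitian] unfolding span_pos_def by blast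
  ultimately show ?thesis using F(1,2) by blast
qed

section \<open>Jordan maps on Hermitian matrices\<close>

definition matrix_unit :: "'n \<Rightarrow> 'n \<Rightarrow> complex \<Rightarrow> complex^'n^'n" where
  "matrix_unit i j a = (\<chi> k l. if k = i \<and> l = j then a else 0)"

text \<open>For \<open>i = j\<close> the two terms add up to \<open>2 Re a\<close> on the diagonal,
  which is why the lemmas on entries, squares and products take distinct indices.\<close>

definition hermitian_pair :: "'n \<Rightarrow> 'n \<Rightarrow> complex \<Rightarrow> complex^'n^'n" where
  "hermitian_pair i j a = matrix_unit i j a + matrix_unit j i (cnj a)"

text \<open>Taken without the factor 1/2, so that it is the polarisation
  \<open>(X + Y)^2 - X^2 - Y^2\<close> of the square.\<close>

definition jordan_prod :: "complex^'n^'n \<Rightarrow> complex^'n^'n \<Rightarrow> complex^'n^'n" where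
  "jordan_prod X Y = X ** Y + Y ** X"

lemma matrix_unit_mult:
  "matrix_unit i j a ** matrix_unit k l b = (if j = k then matrix_unit i l (a * b) else 0)"
proof -
  have "(\<Sum>m\<in>UNIV. (if p = i \<and> m = j then a else 0) * (if m = k \<and> q = l then b else 0))
      = (if j = k \<and> p = i \<and> q = l then a * b else 0)" for p q
    by (subst sum.mono_neutral_right[of UNIV "{j}"]) auto
  then show ?thesis
    by (auto simp: matrix_unit_def matrix_matrix_mult_def vec_eq_iff)
qed

lemma matrix_unit_sandwich:
  "matrix_unit i i 1 ** X ** matrix_unit j j 1 = matrix_unit i j (X $ i $ j)"
proof -
  have "matrix_unit i i 1 ** X = (\<chi> k l. if k = i then X $ i $ l else 0)"
    by (auto simp: matrix_unit_def matrix_matrix_mult_def vec_eq_iff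
        if_distrib[of "\<lambda>x. x * _"] cong: if_cong)
  moreover have "(\<chi> k l. if k = i then X $ i $ l else 0) ** matrix_unit j j 1
      = matrix_unit i j (X $ i $ j)"
  proof -
    have "(\<Sum>m\<in>UNIV. (if p = i then X $ i $ m else 0) * (if m = j \<and> q = j then 1 else 0))
      = (if p = i \<and> q = j then X $ i $ j else 0)" for p q
      by (subst sum.mono_neutral_right[of UNIV "{j}"]) auto
    then show ?thesis
      by (auto simp: matrix_unit_def matrix_matrix_mult_def vec_eq_iff)
  qed
  ultimately show ?thesis by simp
qed

lemma conj_transpose_matrix_unit: "conj_transpose (matrix_unit i j a) = matrix_unit j i (cnj a)"
  by (auto simp: matrix_unit_def conj_transpose_def vec_eq_iff)

lemma matrix_unit_add: "matrix_unit i j a + matrix_unit i j b = matrix_unit i j (a + b)"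
  by (auto simp: matrix_unit_def vec_eq_iff)

lemma matrix_unit_scaleR: "c *\<^sub>R matrix_unit i j a = matrix_unit i j (c *\<^sub>R a)"
  by (auto simp: matrix_unit_def vec_eq_iff)

lemma matrix_unit_nth: "matrix_unit i j a $ k $ l = (if k = i \<and> l = j then a else 0)"
  by (simp add: matrix_unit_def)

lemma hermitian_diag_unit: "hermitian_matrix (matrix_unit i i 1)"
  by (simp add: hermitian_matrix_def conj_transpose_matrix_unit)

lemma hermitian_hermitian_pair: "hermitian_matrix (hermitian_pair i j a)"
  by (simp add: hermitian_matrix_def hermitian_pair_def conj_transpose_add
      conj_transpose_matrix_unit add.commute)

lemma hermitian_nth: "hermitian_matrix X \<Longrightarrow> X $ j $ i = cnj (X $ i $ j)"
  for X :: "complex^'n^'n"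
  by (simp add: hermitian_matrix_def conj_transpose_def vec_eq_iff)

lemma hermitian_pair_nth:
  assumes "i \<noteq> j"
  shows "hermitian_pair i j a $ i $ j = a" "hermitian_pair i j a $ j $ i = cnj a"
  using assms by (simp_all add: hermitian_pair_def matrix_unit_nth)

lemma hermitian_pair_swap: "hermitian_pair j i a = hermitian_pair i j (cnj a)"
  by (simp add: hermitian_pair_def add.commute)

lemma hermitian_pair_add: "hermitian_pair i j (a + b) = hermitian_pair i j a + hermitian_pair i j b"
  by (simp add: hermitian_pair_def add_ac flip: matrix_unit_add)

lemma hermitian_pair_scaleR: "hermitian_pair i j (c *\<^sub>R a) = c *\<^sub>R hermitian_pair i j a"
  by (simp add: hermitian_pair_def scaleR_add_right matrix_unit_scaleR)

lemma hermitian_pair_sq: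
  assumes "i \<noteq> j"
  shows "(hermitian_pair i j a ** hermitian_pair i j a) = (cmod a)\<^sup>2 *\<^sub>R (matrix_unit i i 1 + matrix_unit j j 1)"
  using assms complex_norm_square[of a]
  by (simp add: hermitian_pair_def matrix_ring_simps matrix_unit_mult matrix_unit_scaleR
      scaleR_add_right scaleR_conv_of_real[where 'a=complex] mult.commute add.commute)

text \<open>Only the products meeting in the shared index \<open>j\<close> survive. This is what
  relates the action of a Jordan map on different entries.\<close>

lemma jordan_prod_hermitian_pair:
  assumes "i \<noteq> j" "j \<noteq> k" "i \<noteq> k"
  shows "jordan_prod (hermitian_pair i j a) (hermitian_pair j k b) = hermitian_pair i k (a * b)"
  using assms by (simp add: jordan_prod_def hermitian_pair_def matrix_ring_simps matrix_unit_mult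
      mult.commute)

text \<open>Orthogonality of the two units leaves just the two corner terms. An entry is thus
  isolated by Jordan products with diagonal units alone, so a Jordan map fixing these units acts
  entry by entry.\<close>

lemma jordan_prod_off_diagonal:
  assumes "i \<noteq> j" "hermitian_matrix X"
  shows "jordan_prod (jordan_prod (matrix_unit i i 1) X) (matrix_unit j j 1)
    = hermitian_pair i j (X $ i $ j)"
proof -
  let ?e = "\<lambda>i. matrix_unit i i 1"
  have o: "?e i ** ?e j = 0" "?e j ** ?e i = 0"
    using assms(1) by (simp_all add: matrix_unit_mult)
  have "jordan_prod (jordan_prod (?e i) X) (?e j)
      = ?e i ** X ** ?e j + X ** (?e i ** ?e j) + (?e j ** ?e i) ** X + ?e j ** X ** ?e i"
    by (simp add: jordan_prod_def matrix_ring_simps matrix_mul_assoc)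
  also have "\<dots> = hermitian_pair i j (X $ i $ j)"
    by (simp add: o matrix_unit_sandwich hermitian_pair_def hermitian_nth[OF assms(2), of j i])
  finally show ?thesis .
qed

text \<open>The diagonal counterpart: subtracting the inner Jordan product removes the one-sided
  terms and leaves twice the corner at \<open>i\<close>.\<close>

lemma jordan_prod_diagonal:
  assumes "hermitian_matrix X"
  shows "jordan_prod (jordan_prod (matrix_unit i i 1) X) (matrix_unit i i 1)
    - jordan_prod (matrix_unit i i 1) X = (2 * Re (X $ i $ i)) *\<^sub>R matrix_unit i i 1"
proof -
  let ?e = "matrix_unit i i 1"
  have ee: "?e ** ?e = ?e" by (simp add: matrix_unit_mult)
  have "jordan_prod (jordan_prod ?e X) ?e - jordan_prod ?e X
      = 2 *\<^sub>R (?e ** X ** ?e) + X ** (?e ** ?e) + (?e ** ?e) ** X - (?e ** X + X ** ?e)"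
    by (simp add: jordan_prod_def matrix_ring_simps matrix_mul_assoc scaleR_2)
  also have "\<dots> = 2 *\<^sub>R matrix_unit i i (X $ i $ i)"
    by (simp add: ee matrix_unit_sandwich)
  also have "X $ i $ i = of_real (Re (X $ i $ i))"
    using hermitian_nth[OF assms, of i i] by (metis Reals_cnj_iff of_real_Re)
  finally show ?thesis
    by (simp add: matrix_unit_scaleR scaleR_conv_of_real[where 'a=complex])
qed

text \<open>An isometry of the plane is a rotation or a rotation after conjugation; the ratio
  \<open>z\<close> of \<open>f \<i>\<close> to \<open>f 1\<close> tells which.\<close>

lemma real_linear_isometry_complex:
  fixes f :: "complex \<Rightarrow> complex"
  assumes "linear f" "\<And>a. cmod (f a) = cmod a"
  shows "f \<i> = \<i> * f 1 \<or> f \<i> = - \<i> * f 1"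
    "f \<i> = \<i> * f 1 \<Longrightarrow> f a = f 1 * a" "f \<i> = - \<i> * f 1 \<Longrightarrow> f a = f 1 * cnj a"
proof -
  define z where "z = f \<i> / f 1"
  have f1: "cmod (f 1) = 1" and fi: "cmod (f \<i>) = 1" by (simp_all add: assms(2))
  then have fi_eq: "f \<i> = z * f 1" by (auto simp: z_def)
  have z1: "cmod z = 1" by (simp add: z_def norm_divide f1 fi)
  \<comment> \<open>Preservation of the length of \<open>1 + \<i>\<close> makes \<open>1\<close> and
    \<open>z\<close> orthogonal, so that \<open>Re z = 0\<close>.\<close>
  have "cmod (f (1 + \<i>)) = cmod ((1 + z) * f 1)"
    by (simp add: linear_add[OF assms(1)] fi_eq algebra_simps)
  then have "cmod (1 + z) = cmod (1 + \<i>)"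
    unfolding norm_mult f1 using assms(2)[of "1 + \<i>"] by linarith
  also have "\<dots> = sqrt 2" by (simp add: cmod_def)
  finally have "cmod (1 + z) = sqrt 2" .
  then have "(cmod (1 + z))\<^sup>2 = 2" by simp
  moreover have "(cmod z)\<^sup>2 = 1" by (simp add: z1)
  ultimately have "(1 + Re z)\<^sup>2 + (Im z)\<^sup>2 = 2" and n: "(Re z)\<^sup>2 + (Im z)\<^sup>2 = 1"
    by (simp_all add: cmod_power2)
  then have "Re z = 0" by (simp add: power2_sum)
  with n have "(Im z)\<^sup>2 = 1" by simp
  with \<open>Re z = 0\<close>
  have "z = \<i> \<or> z = - \<i>" by (auto simp: complex_eq_iff power2_eq_1_iff)
  then show "f \<i> = \<i> * f 1 \<or> f \<i> = - \<i> * f 1" by (auto simp: fi_eq)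
  have "f a = f (Re a *\<^sub>R 1 + Im a *\<^sub>R \<i>)"
    by (rule arg_cong[of _ _ f]) (simp add: complex_eq_iff)
  then have "f a = Re a *\<^sub>R f 1 + Im a *\<^sub>R f \<i>"
    by (simp only: linear_add[OF assms(1)] linear_scale[OF assms(1)])
  then have fa: "f a = of_real (Re a) * f 1 + of_real (Im a) * f \<i>"
    by (simp only: scaleR_conv_of_real)
  show "f a = f 1 * a" if "f \<i> = \<i> * f 1"
    by (subst complex_eq[of a]) (simp add: fa that algebra_simps)
  have cnj_a: "cnj a = of_real (Re a) - \<i> * of_real (Im a)" by (simp add: complex_eq_iff)
  show "f a = f 1 * cnj a" if "f \<i> = - \<i> * f 1"
    by (simp add: fa that cnj_a algebra_simps)
qed

lemma jordan_prod_preserved: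
  fixes F :: "complex^'n^'n \<Rightarrow> complex^'n^'n"
  assumes "linear F" and sq: "\<And>X. hermitian_matrix X \<Longrightarrow> F (X ** X) = F X ** F X"
    and X: "hermitian_matrix X" and Y: "hermitian_matrix Y"
  shows "F (jordan_prod X Y) = jordan_prod (F X) (F Y)"
proof -
  have XY: "hermitian_matrix (X + Y)"
    using X Y by (simp add: hermitian_matrix_def conj_transpose_add)
  have j: "jordan_prod X Y = (X + Y) ** (X + Y) - X ** X - Y ** Y" for X Y :: "complex^'n^'n"
    by (simp add: jordan_prod_def matrix_ring_simps)
  show ?thesis
    by (simp only: j linear_diff[OF assms(1)] linear_add[OF assms(1)] sq X Y XY)
qed

lemma hermitian_jordan_prod:
  "hermitian_matrix X \<Longrightarrow> hermitian_matrix Y \<Longrightarrow> hermitian_matrix (jordan_prod X Y)"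
  by (simp add: hermitian_matrix_def jordan_prod_def conj_transpose_add conj_transpose_mult)

text \<open>\<open>G\<close> acts on each off-diagonal entry by a plane isometry
  \<open>g i j\<close>. These isometries multiply along paths of indices, which forces a common type
  and splits their phases as \<open>cnj (d i) * d j\<close>.\<close>

lemma jordan_fixing_diagonal:
  fixes G :: "complex^'n^'n \<Rightarrow> complex^'n^'n"
  assumes lin: "linear G" and herm: "\<And>X. hermitian_matrix X \<Longrightarrow> hermitian_matrix (G X)"
    and sq: "\<And>X. hermitian_matrix X \<Longrightarrow> G (X ** X) = G X ** G X"
    and e: "\<And>i. G (matrix_unit i i 1) = matrix_unit i i 1"
  obtains d :: "'n \<Rightarrow> complex" where "\<And>i. cmod (d i) = 1"
    "(\<forall>X. hermitian_matrix X \<longrightarrow> (\<forall>i j. G X $ i $ j = cnj (d i) * X $ i $ j * d j)) \<or>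
     (\<forall>X. hermitian_matrix X \<longrightarrow> (\<forall>i j. G X $ i $ j = cnj (d i) * X $ j $ i * d j))"
proof -
  have jp: "G (jordan_prod X Y) = jordan_prod (G X) (G Y)"
    if "hermitian_matrix X" "hermitian_matrix Y" for X Y
    by (rule jordan_prod_preserved[OF lin _ that]) (rule sq)
  define g where "g i j a = G (hermitian_pair i j a) $ i $ j" for i j a
  have off: "G (hermitian_pair i j (X $ i $ j)) = hermitian_pair i j (G X $ i $ j)"
    if "i \<noteq> j" "hermitian_matrix X" for i j X
  proof -
    let ?e = "\<lambda>i. matrix_unit i i 1 :: complex^'n^'n"
    have "G (hermitian_pair i j (X $ i $ j)) = G (jordan_prod (jordan_prod (?e i) X) (?e j))"
      by (simp only: jordan_prod_off_diagonal[OF that])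
    also have "\<dots> = jordan_prod (jordan_prod (G (?e i)) (G X)) (G (?e j))"
      by (simp only: jp hermitian_jordan_prod hermitian_diag_unit that)
    also have "\<dots> = hermitian_pair i j (G X $ i $ j)"
      unfolding e by (rule jordan_prod_off_diagonal[OF that(1) herm[OF that(2)]])
    finally show ?thesis .
  qed
  have Gpair: "G (hermitian_pair i j a) = hermitian_pair i j (g i j a)" if "i \<noteq> j" for i j a
    using off[OF that hermitian_hermitian_pair, of i j a] by (simp add: hermitian_pair_nth that g_def)
  have GX: "G X $ i $ j = g i j (X $ i $ j)" if "i \<noteq> j" "hermitian_matrix X" for i j X
    by (simp add: g_def off[OF that] hermitian_pair_nth(1)[OF that(1)])
  have GX_diag: "G X $ i $ i = X $ i $ i" if X: "hermitian_matrix X" for i X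
  proof -
    let ?e = "matrix_unit i i 1 :: complex^'n^'n"
    have "(2 * Re (G X $ i $ i)) *\<^sub>R ?e
        = G (jordan_prod (jordan_prod ?e X) ?e - jordan_prod ?e X)"
      using X
      by (simp add: jordan_prod_diagonal[symmetric] herm linear_diff[OF lin] jp e
          hermitian_jordan_prod hermitian_diag_unit)
    also have "\<dots> = (2 * Re (X $ i $ i)) *\<^sub>R ?e"
      using X by (simp add: jordan_prod_diagonal linear_scale[OF lin] e)
    finally have "((2 * Re (G X $ i $ i)) *\<^sub>R ?e) $ i $ i = ((2 * Re (X $ i $ i)) *\<^sub>R ?e) $ i $ i"
      by (rule arg_cong)
    then have "Re (G X $ i $ i) = Re (X $ i $ i)"
      by (simp add: matrix_unit_nth scaleR_conv_of_real[where 'a=complex] complex_eq_iff)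
    then show ?thesis
      using arg_cong[OF hermitian_nth[OF X, of i i], of Im]
        arg_cong[OF hermitian_nth[OF herm[OF X], of i i], of Im]
      by (simp add: complex_eq_iff)
  qed
  have g_lin: "linear (g i j)" for i j
    by (rule linearI) (simp_all add: g_def hermitian_pair_add hermitian_pair_scaleR
        linear_add[OF lin] linear_scale[OF lin])
  \<comment> \<open>The square of a Hermitian pair is the squared modulus times a sum of diagonal
    units, which \<open>G\<close> fixes.\<close>
  have g_norm: "cmod (g i j a) = cmod a" if ij: "i \<noteq> j" for i j a
  proof -
    have "(cmod (g i j a))\<^sup>2 *\<^sub>R (matrix_unit i i 1 + matrix_unit j j 1 :: complex^'n^'n)
        = G (hermitian_pair i j a ** hermitian_pair i j a)"
      unfolding sq[OF hermitian_hermitian_pair] Gpair[OF ij]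
      by (rule hermitian_pair_sq[OF ij, symmetric])
    also have "\<dots> = (cmod a)\<^sup>2 *\<^sub>R (matrix_unit i i 1 + matrix_unit j j 1)"
      by (simp add: hermitian_pair_sq ij linear_scale[OF lin] linear_add[OF lin] e)
    finally have "((cmod (g i j a))\<^sup>2 *\<^sub>R (matrix_unit i i 1 + matrix_unit j j 1)) $ i $ i
        = ((cmod a)\<^sup>2 *\<^sub>R (matrix_unit i i 1 + matrix_unit j j 1)) $ i $ i"
      by (rule arg_cong)
    then have "(cmod (g i j a))\<^sup>2 = (cmod a)\<^sup>2"
      using ij by (simp add: matrix_unit_nth scaleR_conv_of_real[where 'a=complex]
          del: of_real_power flip: of_real_power)
    then show ?thesis by simp
  qed
  have g_swap: "g j i a = cnj (g i j (cnj a))" if "i \<noteq> j" for i j a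
  proof -
    have "g j i a = G (hermitian_pair i j (cnj a)) $ j $ i"
      by (simp add: g_def hermitian_pair_swap[of j i])
    then show ?thesis by (simp add: Gpair hermitian_pair_nth that)
  qed
  have g_mult: "g i k (a * b) = g i j a * g j k b" if "i \<noteq> j" "j \<noteq> k" "i \<noteq> k" for i j k a b
  proof -
    have "hermitian_pair i k (g i k (a * b)) = hermitian_pair i k (g i j a * g j k b)"
      using that jp[OF hermitian_hermitian_pair hermitian_hermitian_pair, of i j a j k b]
      by (simp add: jordan_prod_hermitian_pair Gpair)
    then have "hermitian_pair i k (g i k (a * b)) $ i $ k
        = hermitian_pair i k (g i j a * g j k b) $ i $ k"
      by (rule arg_cong)
    then show ?thesis by (simp only: hermitian_pair_nth(1)[OF that(3)])
  qed
  have g1: "g i j 1 \<noteq> 0" if "i \<noteq> j" for i j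
    using g_norm[OF that, of 1] by auto
  \<comment> \<open>The type of the isometry: \<open>\<i>\<close> for a direct one,
    \<open>- \<i>\<close> for a conjugate-linear one.\<close>
  define \<tau> where "\<tau> i j = g i j \<i> / g i j 1" for i j
  have gi: "g i j \<i> = \<tau> i j * g i j 1" if "i \<noteq> j" for i j
    using g1[OF that] by (simp add: \<tau>_def)
  have \<tau>: "\<tau> i j = \<i> \<or> \<tau> i j = - \<i>" if "i \<noteq> j" for i j
    using real_linear_isometry_complex(1)[OF g_lin[of i j] g_norm[OF that]] g1[OF that]
    by (auto simp: \<tau>_def)
  \<comment> \<open>Conjugation occurs both on the argument and on the value, and
    \<open>- cnj\<close> fixes \<open>\<i>\<close> and \<open>- \<i>\<close>.\<close>
  have \<tau>_swap: "\<tau> j i = \<tau> i j" if "i \<noteq> j" for i j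
  proof -
    have "g j i \<i> = - cnj (g i j \<i>)"
      by (simp add: g_swap[OF that] linear_neg[OF g_lin])
    moreover have "g j i 1 = cnj (g i j 1)" by (simp add: g_swap[OF that])
    ultimately have "\<tau> j i = - cnj (\<tau> i j)" by (simp add: \<tau>_def)
    then show ?thesis using \<tau>[OF that] by auto
  qed
  \<comment> \<open>On the path \<open>j\<close>, \<open>i\<close>, \<open>k\<close> the factor
    \<open>\<i>\<close> can be put into either entry; equating the two results equates the
    types.\<close>
  have \<tau>_share: "\<tau> i j = \<tau> i k" if "i \<noteq> j" "i \<noteq> k" for i j k
  proof (cases "j = k")
    case False
    have "g j i \<i> * g i k 1 = g j i 1 * g i k \<i>"
      using g_mult[of j i k \<i> 1] g_mult[of j i k 1 \<i>] that False by simp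
    then have "\<tau> j i = \<tau> i k"
      unfolding gi[OF that(2)] gi[OF that(1)[symmetric]]
      using g1[OF that(2)] g1[OF that(1)[symmetric]] by simp
    then show ?thesis using \<tau>_swap[OF that(1)] by simp
  qed simp
  have \<tau>_const: "\<tau> i j = \<tau> p q" if "i \<noteq> j" "p \<noteq> q" for i j p q
  proof (cases "i = p")
    case True
    then show ?thesis using \<tau>_share that by blast
  next
    case False
    then have "\<tau> i j = \<tau> i p" "\<tau> p i = \<tau> p q" "\<tau> p i = \<tau> i p"
      using \<tau>_share[of i j p] \<tau>_share[of p i q] \<tau>_swap[of i p] that by auto
    then show ?thesis by simp
  qed
  \<comment> \<open>An arbitrary reference index: \<open>d i\<close> is the phase of the entry from
    \<open>r\<close> to \<open>i\<close>, and the path \<open>i\<close>, \<open>r\<close>,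
    \<open>j\<close> gives \<open>g_d\<close>.\<close>
  obtain r :: 'n where True by blast
  define d where "d i = (if i = r then 1 else g r i 1)" for i
  have d1: "cmod (d i) = 1" for i by (simp add: d_def g_norm)
  have dd: "cnj (d i) * d i = 1" for i
    using complex_norm_square[of "d i"] by (simp add: d1 mult.commute)
  have g_d: "g i j 1 = cnj (d i) * d j" if "i \<noteq> j" for i j
    using that g_swap[of r i 1] g_mult[of i r j 1 1] by (auto simp: d_def)
  show ?thesis
  \<comment> \<open>The negative case includes dimension one, where there are no off-diagonal
    entries. In the other case one conjugate-linear entry makes all of them so by
    \<open>\<tau>_const\<close>.\<close>
  proof (cases "\<exists>p q. p \<noteq> q \<and> \<tau> p q = - \<i>")
    case False
    have "G X $ i $ j = cnj (d i) * X $ i $ j * d j" if X: "hermitian_matrix X" for X i j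
    proof (cases "i = j")
      case True
      then show ?thesis using GX_diag[OF X, of i] dd[of i] by (simp add: mult_ac)
    next
      case ij: False
      then have "\<tau> i j = \<i>" using \<tau> False by blast
      then show ?thesis
        using real_linear_isometry_complex(2)[OF g_lin[of i j] g_norm[OF ij]]
        by (simp add: GX[OF ij X] gi[OF ij] g_d[OF ij] mult_ac)
    qed
    then show ?thesis using that d1 by blast
  next
    case True
    then obtain p q where pq: "p \<noteq> q" "\<tau> p q = - \<i>" by blast
    have "G X $ i $ j = cnj (d i) * X $ j $ i * d j" if X: "hermitian_matrix X" for X i j
    proof (cases "i = j")
      case True
      then show ?thesis using GX_diag[OF X, of i] dd[of i] by (simp add: mult_ac)
    next
      case ij: False
      then have "\<tau> i j = - \<i>" using \<tau>_const[OF ij pq(1)] pq(2) by simp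
      then show ?thesis
        using real_linear_isometry_complex(3)[OF g_lin[of i j] g_norm[OF ij]]
        by (simp add: GX[OF ij X] gi[OF ij] g_d[OF ij] hermitian_nth[OF X, of j i] mult_ac)
    qed
    then show ?thesis using that d1 by blast
  qed
qed

text \<open>Multiplying the anticommutation relation by \<open>P\<close> on either side produces the
  same middle term \<open>P ** Q ** P\<close>, so \<open>P\<close> and \<open>Q\<close> commute, and
  then the relation says that twice their product is zero.\<close>

lemma idempotent_anticommuting_imp_orthogonal:
  fixes P Q :: "complex^'n^'n"
  assumes "P ** P = P" "P ** Q + Q ** P = 0"
  shows "P ** Q = 0"
proof -
  have "P ** (P ** Q + Q ** P) = P ** Q + P ** Q ** P"
    by (simp add: matrix_ring_simps matrix_mul_assoc assms(1))
  moreover have "(P ** Q + Q ** P) ** P = P ** Q ** P + Q ** (P ** P)"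
    by (simp add: matrix_ring_simps matrix_mul_assoc)
  ultimately have "P ** Q + P ** Q ** P = P ** Q ** P + Q ** P"
    by (simp add: assms)
  then have "P ** Q = Q ** P" by (simp add: add.commute)
  then have "2 *\<^sub>R (P ** Q) = 0" using assms(2) by (simp add: scaleR_2)
  then show ?thesis by simp
qed

theorem hermitian_jordan_unitary:
  fixes F :: "complex^'n^'n \<Rightarrow> complex^'n^'n"
  assumes lin: "linear F" and herm: "\<And>X. hermitian_matrix X \<Longrightarrow> hermitian_matrix (F X)"
    and inj: "\<And>X. hermitian_matrix X \<Longrightarrow> F X = 0 \<Longrightarrow> X = 0"
    and sq: "\<And>X. hermitian_matrix X \<Longrightarrow> F (X ** X) = F X ** F X"
  obtains W :: "complex^'n^'n" where "conj_transpose W ** W = mat 1"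
    "(\<forall>X. hermitian_matrix X \<longrightarrow> F X = conj_transpose W ** X ** W) \<or>
     (\<forall>X. hermitian_matrix X \<longrightarrow> F X = conj_transpose W ** transpose X ** W)"
proof -
  let ?e = "\<lambda>i. matrix_unit i i 1 :: complex^'n^'n"
  define P where "P i = F (?e i)" for i
  have P_adj: "conj_transpose (P i) = P i" for i
    using herm[OF hermitian_diag_unit] by (simp add: P_def hermitian_matrix_def)
  have P_idem: "P i ** P i = P i" for i
    using sq[OF hermitian_diag_unit, of i] by (simp add: P_def matrix_unit_mult)
  have P_orth: "P i ** P j = 0" if "i \<noteq> j" for i j
  proof (rule idempotent_anticommuting_imp_orthogonal[OF P_idem])
    have "P i ** P j + P j ** P i = F (jordan_prod (?e i) (?e j))"
      by (subst jordan_prod_preserved[OF lin])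
        (simp_all add: jordan_prod_def P_def sq hermitian_diag_unit)
    then show "P i ** P j + P j ** P i = 0"
      using that by (simp add: jordan_prod_def matrix_unit_mult linear_0[OF lin])
  qed
  \<comment> \<open>A unit vector in the range of each projection, which is nonzero by injectivity
    of \<open>F\<close>. Orthogonality of the projections makes these vectors orthonormal.\<close>
  have "\<exists>u. P i *v u = u \<and> cinner u u = 1" for i
  proof -
    have "P i \<noteq> 0"
    proof
      assume "P i = 0"
      then have "?e i = 0" using inj[OF hermitian_diag_unit] by (simp add: P_def)
      then have "?e i $ i $ i = 0" by simp
      then show False by (simp add: matrix_unit_nth)
    qed
    then obtain x where x: "P i *v x \<noteq> 0"
      by (metis matrix_eq matrix_vector_mult_0)
    let ?u = "(1 / norm (P i *v x)) *\<^sub>R (P i *v x)"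
    have "P i *v ?u = ?u"
      by (simp add: linear_scale[OF matrix_vector_mul_linear] matrix_vector_mul_assoc P_idem)
    moreover have "cinner ?u ?u = 1" using x by (simp add: cinner_self)
    ultimately show ?thesis by blast
  qed
  then obtain u where Pu: "\<And>i. P i *v u i = u i" and uu: "\<And>i. cinner (u i) (u i) = 1"
    by metis
  have Pu0: "P i *v u j = 0" if "i \<noteq> j" for i j
  proof -
    have "P i *v u j = (P i ** P j) *v u j" by (simp add: Pu flip: matrix_vector_mul_assoc)
    then show ?thesis by (simp add: P_orth that)
  qed
  have on: "cinner (u i) (u j) = (if i = j then 1 else 0)" for i j
  proof (cases "i = j")
    case False
    have "cinner (u i) (u j) = cinner (P i *v u i) (u j)" by (simp add: Pu)
    also have "\<dots> = cinner (u i) (P i *v u j)" by (simp only: cinner_matrix_vector P_adj)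
    also have "\<dots> = 0" by (simp add: Pu0 False cinner_def)
    finally show ?thesis using False by simp
  qed (simp add: uu)
  define U where "U = (\<chi> k i. u i $ k)"
  have U: "conj_transpose U ** U = mat 1"
    unfolding U_def by (rule unitary_of_orthonormal[OF on])
  then have U': "U ** conj_transpose U = mat 1" by (simp add: unitary_sym)
  \<comment> \<open>\<open>P i\<close> fixes column \<open>i\<close> of \<open>U\<close> and kills
    the others, so in this basis it is the diagonal unit itself and has rank one.\<close>
  have PU: "P i ** U = U ** ?e i" for i
  proof -
    have "(P i ** U) $ k $ l = (U ** ?e i) $ k $ l" for k l
    proof -
      have "(P i ** U) $ k $ l = (P i *v u l) $ k"
        by (simp add: U_def matrix_matrix_mult_def matrix_vector_mult_def)
      also have "\<dots> = (if l = i then u l $ k else 0)" using Pu Pu0 by auto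
      also have "\<dots> = (U ** ?e i) $ k $ l"
        by (auto simp: U_def matrix_matrix_mult_def matrix_unit_def
            if_distrib[of "\<lambda>x. _ * x"] cong: if_cong)
      finally show ?thesis .
    qed
    then show ?thesis by (simp add: vec_eq_iff)
  qed
  define G where "G X = conj_transpose U ** F X ** U" for X
  have F_G: "F X = U ** G X ** conj_transpose U" for X
  proof -
    have "U ** G X ** conj_transpose U = (U ** conj_transpose U) ** F X ** (U ** conj_transpose U)"
      by (simp only: G_def matrix_mul_assoc)
    then show ?thesis by (simp add: U')
  qed
  have G_lin: "linear G"
    by (rule linearI) (simp_all add: G_def linear_add[OF lin] linear_scale[OF lin] matrix_ring_simps)
  have G_herm: "hermitian_matrix (G X)" if "hermitian_matrix X" for X
    using herm[OF that] by (simp add: G_def hermitian_matrix_def conj_transpose_mult matrix_mul_assoc)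
  have G_sq: "G (X ** X) = G X ** G X" if "hermitian_matrix X" for X
  proof -
    have "G X ** G X = conj_transpose U ** F X ** (U ** conj_transpose U) ** F X ** U"
      by (simp only: G_def matrix_mul_assoc)
    then show ?thesis by (simp add: U' G_def sq that matrix_mul_assoc)
  qed
  have G_e: "G (?e i) = ?e i" for i
  proof -
    have "G (?e i) = conj_transpose U ** (P i ** U)" by (simp add: G_def P_def matrix_mul_assoc)
    also have "\<dots> = (conj_transpose U ** U) ** ?e i" by (simp only: PU matrix_mul_assoc)
    finally show ?thesis by (simp add: U)
  qed
  obtain d where d: "\<And>i. cmod (d i) = 1" and G:
    "(\<forall>X. hermitian_matrix X \<longrightarrow> (\<forall>i j. G X $ i $ j = cnj (d i) * X $ i $ j * d j)) \<or>
     (\<forall>X. hermitian_matrix X \<longrightarrow> (\<forall>i j. G X $ i $ j = cnj (d i) * X $ j $ i * d j))"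
    using jordan_fixing_diagonal[OF G_lin G_herm G_sq G_e] by blast
  \<comment> \<open>The phases form a diagonal unitary, so the entrywise formula for
    \<open>G\<close> is a congruence by \<open>D\<close>.\<close>
  define D :: "complex^'n^'n" where "D = (\<chi> i j. if i = j then d i else 0)"
  have D_conj: "(conj_transpose D ** Y ** D) $ i $ j = cnj (d i) * Y $ i $ j * d j" for Y i j
  proof -
    have "(conj_transpose D ** Y) $ i $ k = cnj (d i) * Y $ i $ k" for k
    proof -
      have "(conj_transpose D ** Y) $ i $ k = (\<Sum>m\<in>UNIV. cnj (D $ m $ i) * Y $ m $ k)"
        by (simp add: matrix_matrix_mult_def conj_transpose_def)
      also have "\<dots> = (\<Sum>m\<in>UNIV. if m = i then cnj (d i) * Y $ i $ k else 0)"
        by (rule sum.cong) (auto simp: D_def)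
      finally show ?thesis by simp
    qed
    then have "(conj_transpose D ** Y ** D) $ i $ j = (\<Sum>m\<in>UNIV. cnj (d i) * Y $ i $ m * D $ m $ j)"
      by (simp add: matrix_matrix_mult_def[of "conj_transpose D ** Y"])
    also have "\<dots> = (\<Sum>m\<in>UNIV. if m = j then cnj (d i) * Y $ i $ j * d j else 0)"
      by (rule sum.cong) (auto simp: D_def)
    finally show ?thesis by simp
  qed
  have D: "conj_transpose D ** D = mat 1"
  proof -
    have "(conj_transpose D ** mat 1 ** D) $ i $ j = (mat 1 :: complex^'n^'n) $ i $ j" for i j
      unfolding D_conj using d[of i] complex_norm_square[of "d i"]
      by (auto simp: mat_def mult.commute)
    then show ?thesis by (simp add: vec_eq_iff)
  qed
  define W where "W = D ** conj_transpose U"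
  \<comment> \<open>\<open>Y\<close> will be \<open>X\<close> or its transpose, so both alternatives
    are handled at once.\<close>
  have F_W: "F X = conj_transpose W ** Y ** W" if "\<And>i j. G X $ i $ j = cnj (d i) * Y $ i $ j * d j" for X Y
  proof -
    have "G X = conj_transpose D ** Y ** D" by (simp add: vec_eq_iff that D_conj)
    then show ?thesis by (simp add: F_G W_def conj_transpose_mult matrix_mul_assoc)
  qed
  have "conj_transpose W ** W = U ** (conj_transpose D ** D) ** conj_transpose U"
    by (simp add: W_def conj_transpose_mult matrix_mul_assoc)
  then have "conj_transpose W ** W = mat 1" by (simp add: D U')
  moreover from G have "(\<forall>X. hermitian_matrix X \<longrightarrow> F X = conj_transpose W ** X ** W) \<or>
     (\<forall>X. hermitian_matrix X \<longrightarrow> F X = conj_transpose W ** transpose X ** W)"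
  proof
    assume "\<forall>X. hermitian_matrix X \<longrightarrow> (\<forall>i j. G X $ i $ j = cnj (d i) * X $ i $ j * d j)"
    then show ?thesis by (intro disjI1 allI impI F_W) blast
  next
    assume "\<forall>X. hermitian_matrix X \<longrightarrow> (\<forall>i j. G X $ i $ j = cnj (d i) * X $ j $ i * d j)"
    then show ?thesis by (intro disjI2 allI impI F_W) (simp add: transpose_def)
  qed
  ultimately show ?thesis using that by blast
qed

section \<open>From the trace condition to a congruence\<close>

lemma trace_preserving_imp_congruence:
  fixes \<phi> :: "complex^'n^'n \<Rightarrow> complex^'n^'n"
  assumes maps: "\<And>A. A \<in> pos_def_matrices \<Longrightarrow> \<phi> A \<in> pos_def_matrices"
    and tr: "\<And>A B. A \<in> pos_def_matrices \<Longrightarrow> B \<in> pos_def_matrices \<Longrightarrow>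
      trace (\<phi> A ** matrix_inv (\<phi> B)) = trace (A ** matrix_inv B)"
  obtains N where "invertible N"
    "(\<forall>A\<in>pos_def_matrices. \<phi> A = conj_transpose N ** A ** N) \<or>
     (\<forall>A\<in>pos_def_matrices. \<phi> A = conj_transpose N ** transpose A ** N)"
proof -
  \<comment> \<open>Normalisation: congruence by the inverse \<open>T\<close> of this factor turns
    \<open>\<phi>\<close> into a map \<open>\<psi>\<close> fixing the identity.\<close>
  obtain S :: "complex^'n^'n" where S: "invertible S" and \<phi>1: "\<phi> (mat 1) = conj_transpose S ** S"
    using pos_def_factor[OF maps[OF pos_def_mat_1]] by blast
  define T where "T = matrix_inv S"
  have T: "invertible T" "S ** T = mat 1" "T ** S = mat 1"
    using invertible_matrix_inv[OF S] matrix_inv_mult[OF S] by (simp_all add: T_def)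
  have T': "conj_transpose T ** conj_transpose S = mat 1"
    "conj_transpose S ** conj_transpose T = mat 1"
    by (simp_all add: conj_transpose_mult[symmetric] T)
  define \<psi> where "\<psi> A = conj_transpose T ** \<phi> A ** T" for A
  have \<phi>\<psi>: "\<phi> A = conj_transpose S ** \<psi> A ** S" for A
  proof -
    have "conj_transpose S ** \<psi> A ** S
        = (conj_transpose S ** conj_transpose T) ** \<phi> A ** (T ** S)"
      by (simp only: \<psi>_def matrix_mul_assoc)
    then show ?thesis by (simp add: T T')
  qed
  have \<psi>_maps: "\<psi> A \<in> pos_def_matrices" if "A \<in> pos_def_matrices" for A
    unfolding \<psi>_def by (rule pos_def_congruence[OF maps[OF that] T(1)])
  have \<psi>1: "\<psi> (mat 1) = mat 1"
  proof -
    have "\<psi> (mat 1) = (conj_transpose T ** conj_transpose S) ** (S ** T)"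
      by (simp only: \<psi>_def \<phi>1 matrix_mul_assoc)
    then show ?thesis by (simp add: T T')
  qed
  \<comment> \<open>The inverse of \<open>\<psi> B\<close> is a congruence of that of
    \<open>\<phi> B\<close> by the inverse factors; they cancel in the trace after a cyclic
    permutation.\<close>
  have \<psi>_tr: "trace (\<psi> A ** matrix_inv (\<psi> B)) = trace (A ** matrix_inv B)"
    if "A \<in> pos_def_matrices" "B \<in> pos_def_matrices" for A B
  proof -
    let ?K = "matrix_inv (\<phi> B)"
    have "matrix_inv (\<psi> B) = S ** ?K ** conj_transpose S"
    proof (rule matrix_inv_eq)
      have "\<psi> B ** (S ** ?K ** conj_transpose S)
          = conj_transpose T ** (\<phi> B ** ((T ** S) ** ?K)) ** conj_transpose S"
        by (simp only: \<psi>_def matrix_mul_assoc)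
      then show "\<psi> B ** (S ** ?K ** conj_transpose S) = mat 1"
        by (simp add: T T' matrix_inv_mult pos_def_invertible maps that)
    qed
    then have "\<psi> A ** matrix_inv (\<psi> B)
        = conj_transpose T ** (\<phi> A ** (T ** S) ** ?K ** conj_transpose S)"
      by (simp only: \<psi>_def matrix_mul_assoc)
    then have "trace (\<psi> A ** matrix_inv (\<psi> B))
        = trace (\<phi> A ** (T ** S) ** ?K ** conj_transpose S ** conj_transpose T)"
      by (simp only: trace_mul_sym[of "conj_transpose T"])
    also have "\<dots> = trace (\<phi> A ** ?K)"
      using T'(2) by (simp add: T flip: matrix_mul_assoc)
    finally show ?thesis by (simp add: tr that)
  qed
  obtain F where F: "linear F" "\<forall>A\<in>pos_def_matrices. F A = \<psi> A"
    and FX: "\<forall>X. hermitian_matrix X \<longrightarrow>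
      hermitian_matrix (F X) \<and> (F X = 0 \<longrightarrow> X = 0) \<and> F (X ** X) = F X ** F X"
    using unital_trace_preserving_imp_jordan[of \<psi>] \<psi>_maps \<psi>1 \<psi>_tr by auto
  obtain W :: "complex^'n^'n" where W: "conj_transpose W ** W = mat 1" and
    FW: "(\<forall>X. hermitian_matrix X \<longrightarrow> F X = conj_transpose W ** X ** W) \<or>
     (\<forall>X. hermitian_matrix X \<longrightarrow> F X = conj_transpose W ** transpose X ** W)"
    by (rule hermitian_jordan_unitary[OF F(1)]) (use FX in auto)
  \<comment> \<open>The witness combines the unitary \<open>W\<close> of the normalised map with the
    factor \<open>S\<close> that undoes the normalisation.\<close>
  have "invertible (W ** S)"
    using W S by (intro invertible_mult) (auto simp: invertible_left_inverse)
  moreover have "\<phi> A = conj_transpose (W ** S) ** Y ** (W ** S)"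
    if "A \<in> pos_def_matrices" "F A = conj_transpose W ** Y ** W" for A Y
    using that F(2) by (simp add: \<phi>\<psi>[of A] conj_transpose_mult matrix_mul_assoc)
  ultimately show ?thesis
    using that[of "W ** S"] FW pos_def_hermitian by blast
qed

theorem theorem3p1:
  fixes \<phi> :: "complex^'n^'n \<Rightarrow> complex^'n^'n" and \<alpha> :: real
  assumes maps: "\<phi> \<in> pos_def_matrices \<rightarrow> pos_def_matrices"
    and alpha: "\<alpha> = root CARD('n) (Re (det (\<phi> (mat 1))))"
  defines "stmt1 \<equiv>
      (\<exists>M :: complex^'n^'n. invertible M \<and> det (conj_transpose M ** M) = 1 \<and>
         ((\<forall>A\<in>pos_def_matrices. \<phi> A = \<alpha> *\<^sub>R (conj_transpose M ** A ** M)) \<or>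
          (\<forall>A\<in>pos_def_matrices. \<phi> A = \<alpha> *\<^sub>R (conj_transpose M ** transpose A ** M))))"
    and "stmt2 \<equiv>
      (\<forall>A\<in>pos_def_matrices. \<forall>B\<in>pos_def_matrices.
         det (\<phi> A + \<phi> B) = complex_of_real (\<alpha> ^ CARD('n)) * det (A + B))"
    and "stmt3 \<equiv>
      (\<forall>A\<in>pos_def_matrices. \<forall>B\<in>pos_def_matrices.
         trace (\<phi> A ** matrix_inv (\<phi> B)) = trace (A ** matrix_inv B))"
  shows "(stmt1 \<longleftrightarrow> stmt2) \<and> (stmt2 \<longleftrightarrow> stmt3)"
proof -
  let ?P = "pos_def_matrices :: (complex^'n^'n) set"
  have maps': "\<phi> A \<in> ?P" if "A \<in> ?P" for A using maps that by auto
  obtain r where r: "r > 0" "det (\<phi> (mat 1)) = of_real r"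
    using pos_def_det[OF maps'[OF pos_def_mat_1]] by blast
  \<comment> \<open>The determinant of a positive definite matrix is real and positive, so passing
    to \<open>Re\<close> in \<open>alpha\<close> loses nothing.\<close>
  have \<alpha>: "\<alpha> > 0" "complex_of_real \<alpha> ^ CARD('n) = det (\<phi> (mat 1))"
    using r by (simp_all add: alpha real_root_pow_pos flip: of_real_power)
  have "stmt2" if "stmt1"
    unfolding stmt2_def
  proof (intro ballI)
    fix A B assume AB: "A \<in> ?P" "B \<in> ?P"
    \<comment> \<open>\<open>t\<close> covers both alternatives; all that matters below is that it
      is additive and preserves determinants.\<close>
    obtain M :: "complex^'n^'n" and t where M: "det (conj_transpose M ** M) = 1"
      and t: "t = id \<or> t = transpose"
      and \<phi>: "\<And>A. A \<in> ?P \<Longrightarrow> \<phi> A = \<alpha> *\<^sub>R (conj_transpose M ** t A ** M)"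
    proof -
      from \<open>stmt1\<close> obtain M :: "complex^'n^'n" where M: "det (conj_transpose M ** M) = 1"
        "(\<forall>A\<in>?P. \<phi> A = \<alpha> *\<^sub>R (conj_transpose M ** A ** M)) \<or>
         (\<forall>A\<in>?P. \<phi> A = \<alpha> *\<^sub>R (conj_transpose M ** transpose A ** M))"
        unfolding stmt1_def by blast
      from M(2) show thesis
      proof
        assume "\<forall>A\<in>?P. \<phi> A = \<alpha> *\<^sub>R (conj_transpose M ** A ** M)"
        then show thesis using that[OF M(1), of id] by simp
      next
        assume "\<forall>A\<in>?P. \<phi> A = \<alpha> *\<^sub>R (conj_transpose M ** transpose A ** M)"
        then show thesis using that[OF M(1), of transpose] by simp
      qed
    qed
    have "\<phi> A + \<phi> B = \<alpha> *\<^sub>R (conj_transpose M ** (t A + t B) ** M)"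
      by (simp add: \<phi> AB matrix_ring_simps scaleR_add_right)
    moreover have "det (t A + t B) = det (A + B)"
    proof -
      have "t A + t B = t (A + B)" using t by (auto simp: transpose_def vec_eq_iff)
      then show ?thesis using t by auto
    qed
    ultimately show "det (\<phi> A + \<phi> B) = complex_of_real (\<alpha> ^ CARD('n)) * det (A + B)"
      using M by (simp add: det_scaleR det_mul mult_ac)
  qed
  moreover have "stmt3" if "stmt2"
  proof -
    have det: "det (\<phi> A + \<phi> B) = complex_of_real (\<alpha> ^ CARD('n)) * det (A + B)"
      if "A \<in> ?P" "B \<in> ?P" for A B
      using \<open>stmt2\<close> that unfolding stmt2_def by blast
    show ?thesis
      unfolding stmt3_def
      by (intro ballI) (rule det_preserving_imp_trace_preserving[of \<phi>, OF maps' det])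
  qed
  moreover have "stmt1" if "stmt3"
  proof -
    have tr: "trace (\<phi> A ** matrix_inv (\<phi> B)) = trace (A ** matrix_inv B)"
      if "A \<in> ?P" "B \<in> ?P" for A B
      using \<open>stmt3\<close> that unfolding stmt3_def by blast
    obtain N :: "complex^'n^'n" where N: "invertible N" and
      \<phi>: "(\<forall>A\<in>?P. \<phi> A = conj_transpose N ** A ** N) \<or>
        (\<forall>A\<in>?P. \<phi> A = conj_transpose N ** transpose A ** N)"
      by (rule trace_preserving_imp_congruence[of \<phi>, OF maps' tr])
    \<comment> \<open>\<open>M\<close> enters the congruence twice, so the square root extracts
      exactly one factor \<open>\<alpha>\<close>.\<close>
    define M where "M = (1 / sqrt \<alpha>) *\<^sub>R N"
    have M: "\<alpha> *\<^sub>R (conj_transpose M ** X ** M) = conj_transpose N ** X ** N" for X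
      using \<alpha>(1) by (simp add: M_def conj_transpose_scaleR matrix_ring_simps)
    have \<phi>1: "\<phi> (mat 1) = conj_transpose N ** N"
      using \<phi> pos_def_mat_1 by auto
    \<comment> \<open>Evaluation at the identity: the determinant of \<open>\<phi> (mat 1)\<close>
      is also the \<open>n\<close>-th power of \<open>\<alpha>\<close>, which forces the remaining
      factor to be 1.\<close>
    have "of_real \<alpha> ^ CARD('n) * det (conj_transpose M ** M) = det (\<phi> (mat 1))"
      using M[of "mat 1"] by (simp add: \<phi>1 flip: det_scaleR)
    then have M1: "det (conj_transpose M ** M) = 1"
      using \<alpha> by (metis mult_cancel_left1 of_real_eq_0_iff order_less_irrefl power_not_zero)
    then have "det M \<noteq> 0" by (auto simp: det_mul)
    then have "invertible M" by (simp add: invertible_det_nz)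
    then show ?thesis
      unfolding stmt1_def using \<phi> M1 by (intro exI[of _ M]) (simp add: M)
  qed
  ultimately show ?thesis by blast
qed

end
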